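(* Consider the detection problem ${\rm CHC}_D(\mathbf k,\mathbf n,\lambda)$ under regime (A1), and assume that for all $i\ne j$ in $[d]$, $$\frac{\log(n_j/k_j)}{k_i}\to0,\qquad\frac{\log\log(n_i/k_i)}{\log(n_j/k_j)}\to0,\qquad k_i\log\frac{n_i}{k_i}\asymp k_j\log\frac{n_j}{k_j}.$$ If $$\frac{\lambda\prod_{i=1}^dk_i}{\sqrt{\prod_{i=1}^dn_i}}\to0\quad\text{and}\quad\limsup\frac{\lambda\big(\prod_{i=1}^dk_i\big)^{1/2}}{\sqrt{2\sum_{i=1}^dk_i\log(n_i/k_i)}}<1,$$ then $\mathcal E^s_{{\rm CHC}_D}\to1$. Moreover, under regime (A2), if $\beta>(d\alpha-d/2)\vee((d-1)\alpha/2)$, then $\mathcal E^s_{{\rm CHC}_D}\to1$.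
   Context: Model: $\mathcal Y=\mathcal X+\mathcal Z\in\mathbb R^{n_1\times\cdots\times n_d}$, $\mathcal Z$ with i.i.d. $N(0,1)$ entries. ${\rm CHC}_D(\mathbf k,\mathbf n,\lambda)$ is the test of $H_0:\mathcal X=0$ versus $H_1:\mathcal X\in\mathscr X_{\rm CHC}(\mathbf k,\mathbf n,\lambda)=\{\lambda'\mathbf 1_{I_1}\circ\cdots\circ\mathbf 1_{I_d}:I_i\subseteq[n_i],|I_i|=k_i,\lambda'\ge\lambda\}$. The risk of a test $\phi$ is $\mathbb P_0(\phi=1)+\sup_{\mathcal X\in\mathscr X_{\rm CHC}}\mathbb P_{\mathcal X}(\phi=0)$, and $\mathcal E^s_{{\rm CHC}_D}$ is its infimum over all tests. $a_n\asymp b_n$ means $c\,a_n\le b_n\le Ca_n$ for constants $c,C>0$. Regime (A1): for all $i$, $n_i\to\infty,k_i\to\infty,k_i/n_i\to0$. Regime (A2): fixed $\alpha\in[0,1],\beta\in\mathbb R$; $n\to\infty$, $n_1=\dots=n_d$ with $\log n_i/\log n\to1$, $k_i=k$ with $\log k/\log n\to\alpha$, $\log(1/\lambda)/\log n\to\beta$.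
   Formalization: The tensor order is assumed to satisfy d ≥ 2; for d = 1 the first claim is false (e.g. k = n^{0.4}, λ = √(0.6 log n) meets all conditions but the signal is detectable). *)

theory Defs
  imports "HOL-Probability.Probability"
begin

text \<open>Index set of an order-d tensor of size n 0 x ... x n (d-1): lists of length d.\<close>
definition tidx :: "nat \<Rightarrow> (nat \<Rightarrow> nat) \<Rightarrow> nat list set" where
  "tidx d n = {x. length x = d \<and> (\<forall>i<d. x ! i < n i)}"

text \<open>Law of Y = X + Z with Z having i.i.d. N(0,1) entries.\<close>
definition obs_law :: "nat \<Rightarrow> (nat \<Rightarrow> nat) \<Rightarrow> (nat list \<Rightarrow> real) \<Rightarrow> (nat list \<Rightarrow> real) measure" where
  "obs_law d n X = PiM (tidx d n) (\<lambda>j. density lborel (\<lambda>y. ennreal (normal_density (X j) 1 y)))"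

definition chc_tensor :: "nat \<Rightarrow> real \<Rightarrow> (nat \<Rightarrow> nat set) \<Rightarrow> nat list \<Rightarrow> real" where
  "chc_tensor d lam I = (\<lambda>x. lam * (\<Prod>i<d. indicator (I i) (x ! i)))"

definition chc_class :: "nat \<Rightarrow> (nat \<Rightarrow> nat) \<Rightarrow> (nat \<Rightarrow> nat) \<Rightarrow> real \<Rightarrow> (nat list \<Rightarrow> real) set" where
  "chc_class d n k lam = {chc_tensor d l I | l I. l \<ge> lam \<and>
      (\<forall>i<d. I i \<subseteq> {..<n i} \<and> card (I i) = k i)}"

text \<open>Tests: measurable maps from the sample space to {0,1} (True = reject H0).\<close>
definition tests :: "nat \<Rightarrow> (nat \<Rightarrow> nat) \<Rightarrow> ((nat list \<Rightarrow> real) \<Rightarrow> bool) set" where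
  "tests d n = {\<phi>. \<phi> \<in> measurable (PiM (tidx d n) (\<lambda>_. borel)) (count_space UNIV)}"

definition test_risk :: "nat \<Rightarrow> (nat \<Rightarrow> nat) \<Rightarrow> (nat \<Rightarrow> nat) \<Rightarrow> real \<Rightarrow> ((nat list \<Rightarrow> real) \<Rightarrow> bool) \<Rightarrow> real" where
  "test_risk d n k lam \<phi> =
     measure (obs_law d n (\<lambda>_. 0)) {y \<in> space (obs_law d n (\<lambda>_. 0)). \<phi> y}
     + (SUP X \<in> chc_class d n k lam. measure (obs_law d n X) {y \<in> space (obs_law d n X). \<not> \<phi> y})"

definition minimax_risk :: "nat \<Rightarrow> (nat \<Rightarrow> nat) \<Rightarrow> (nat \<Rightarrow> nat) \<Rightarrow> real \<Rightarrow> real" where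
  "minimax_risk d n k lam = (INF \<phi> \<in> tests d n. test_risk d n k lam \<phi>)"

definition asymp_same_order :: "(nat \<Rightarrow> real) \<Rightarrow> (nat \<Rightarrow> real) \<Rightarrow> bool" where
  "asymp_same_order a b \<longleftrightarrow> (\<exists>c C. c > 0 \<and> C > 0 \<and>
      eventually (\<lambda>t. c * a t \<le> b t \<and> b t \<le> C * a t) sequentially)"

text \<open>Regime (A1); sequences indexed by t, n t i = n_i, k t i = k_i.\<close>
definition regime_A1 :: "nat \<Rightarrow> (nat \<Rightarrow> nat \<Rightarrow> nat) \<Rightarrow> (nat \<Rightarrow> nat \<Rightarrow> nat) \<Rightarrow> bool" where
  "regime_A1 d n k \<longleftrightarrow> (\<forall>i<d.
      filterlim (\<lambda>t. real (n t i)) at_top sequentially \<and>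
      filterlim (\<lambda>t. real (k t i)) at_top sequentially \<and>
      (\<lambda>t. real (k t i) / real (n t i)) \<longlonglongrightarrow> 0)"

text \<open>Regime (A2); the sequence index t plays the role of n.\<close>
definition regime_A2 :: "nat \<Rightarrow> (nat \<Rightarrow> nat \<Rightarrow> nat) \<Rightarrow> (nat \<Rightarrow> nat \<Rightarrow> nat) \<Rightarrow> (nat \<Rightarrow> real)
    \<Rightarrow> real \<Rightarrow> real \<Rightarrow> bool" where
  "regime_A2 d n k lam \<alpha> \<beta> \<longleftrightarrow> 0 \<le> \<alpha> \<and> \<alpha> \<le> 1 \<and>
     (\<exists>N K :: nat \<Rightarrow> nat. (\<forall>t. \<forall>i<d. n t i = N t \<and> k t i = K t) \<and>
        (\<lambda>t. ln (real (N t)) / ln (real t)) \<longlonglongrightarrow> 1 \<and>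
        (\<lambda>t. ln (real (K t)) / ln (real t)) \<longlonglongrightarrow> \<alpha> \<and>
        (\<lambda>t. ln (1 / lam t) / ln (real t)) \<longlonglongrightarrow> \<beta>)"

end

theory Submission
  imports Defs
begin

text \<open>The prior is uniform over planted blocks \<open>I\<^sub>1 \<times> \<dots> \<times> I\<^sub>d\<close> of height \<open>\<lambda>\<close>. The plain second moment
of the likelihood ratio is of size \<open>exp (\<lambda>\<^sup>2 k\<^sub>1 \<cdots> k\<^sub>d)\<close> on the event of full overlap, which loses a factor
2 in \<open>\<lambda>\<^sup>2\<close>. Each likelihood ratio is therefore truncated to the event that every sub-block \<open>V\<close> of the
planted block has sum at most \<open>\<lambda> |V| + (2 |V| E)\<^sup>1\<^sup>/\<^sup>2\<close>. With \<open>E = 2 \<Sum> k\<^sub>i\<close> this event is typical under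
the alternative, since there are only \<open>2 ^ (\<Sum> k\<^sub>i)\<close> sub-blocks, and \<open>E\<close> is negligible against
\<open>\<Sum> k\<^sub>i log (n\<^sub>i / k\<^sub>i)\<close>; on it two planted blocks meeting in \<open>v\<close> cells contribute only about
\<open>exp (\<lambda>\<^sup>2 v / 2)\<close>. The overlaps \<open>h\<^sub>i\<close> are hypergeometric with
\<open>P (h\<^sub>i = h) \<le> (k\<^sub>i choose h) (k\<^sub>i / n\<^sub>i) ^ h\<close>. If all \<open>h\<^sub>i\<close> are near or below their means, \<open>\<lambda>\<^sup>2 v\<close> is small;
if all ratios \<open>h\<^sub>i / k\<^sub>i\<close> are bounded below, the truncation is used; otherwise some atypically large
\<open>h\<^sub>j\<close> beats \<open>exp (\<lambda>\<^sup>2 v)\<close> by itself. In regime (A2) the middle case does not occur.\<close>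

section \<open>Likelihood ratios of Gaussian tensors\<close>

lemma finite_tidx: "finite (tidx d n)"
proof (rule finite_subset)
  show "tidx d n \<subseteq> {xs. set xs \<subseteq> (\<Union>i<d. {..<n i}) \<and> length xs = d}"
    by (force simp: tidx_def in_set_conv_nth)
  show "finite {xs. set xs \<subseteq> (\<Union>i<d. {..<n i}) \<and> length xs = d}"
    by (intro finite_lists_length_eq) auto
qed

section \<open>Change of measure from pure noise to signal plus noise\<close>

lemma sets_obs_law: "sets (obs_law d n X) = sets (PiM (tidx d n) (\<lambda>_. borel))"
  unfolding obs_law_def by (intro sets_PiM_cong) auto

lemma space_obs_law: "space (obs_law d n X) = space (PiM (tidx d n) (\<lambda>_. borel))"
  by (rule sets_eq_imp_space_eq[OF sets_obs_law])

lemma product_prob_space_normal: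
  "product_prob_space (\<lambda>j. density lborel (\<lambda>y. ennreal (normal_density (X j) 1 y)))"
  by (intro product_prob_spaceI prob_space_normal_density) simp

lemma prob_space_obs_law: "prob_space (obs_law d n X)"
proof -
  interpret product_prob_space "\<lambda>j. density lborel (\<lambda>y. ennreal (normal_density (X j) 1 y))"
    by (rule product_prob_space_normal)
  show ?thesis
    unfolding obs_law_def by (rule prob_space_PiM) (rule M.prob_space_axioms)
qed

lemma normal_density_shift:
  "normal_density m 1 y = exp (m * y - m\<^sup>2 / 2) * normal_density 0 1 y"
  by (simp add: normal_density_def mult.assoc exp_add[symmetric] mult_exp_exp power2_eq_square algebra_simps)
     (simp add: field_simps)

text \<open>The Radon-Nikodym derivative of the law with mean \<open>c\<close> against pure noise,
  with the product over the cells collected into a single exponential.\<close>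

definition likelihood :: "nat list set \<Rightarrow> (nat list \<Rightarrow> real) \<Rightarrow> (nat list \<Rightarrow> real) \<Rightarrow> real" where
  "likelihood T c y = exp (\<Sum>x\<in>T. c x * y x - (c x)\<^sup>2 / 2)"

lemma likelihood_measurable [measurable]:
  "likelihood (tidx d n) c \<in> borel_measurable (PiM (tidx d n) (\<lambda>_. borel))"
  unfolding likelihood_def[abs_def] by measurable

lemma likelihood_measurable_obs_law:
  "likelihood (tidx d n) c \<in> borel_measurable (obs_law d n X)"
  using likelihood_measurable by (simp add: measurable_cong_sets[OF sets_obs_law refl])

text \<open>Product measures are determined by their values on boxes. On a box the density and the
  indicator are both products over cells, so the integral factorizes into one-dimensional ones, and
  each of these is \<open>normal_density_shift\<close>.\<close>

lemma obs_law_density: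
  "obs_law d n X = density (obs_law d n (\<lambda>_. 0)) (\<lambda>y. ennreal (likelihood (tidx d n) X y))"
proof -
  let ?T = "tidx d n"
  let ?N = "\<lambda>m. density lborel (\<lambda>y. ennreal (normal_density m 1 y))"
  interpret P: product_prob_space "\<lambda>j. ?N (X j)"
    by (rule product_prob_space_normal)
  interpret Q: product_prob_space "\<lambda>j::nat list. ?N 0"
    using product_prob_space_normal[of "\<lambda>_. 0"] .
  have "density (obs_law d n (\<lambda>_. 0)) (\<lambda>y. ennreal (likelihood ?T X y)) = PiM ?T (\<lambda>j. ?N (X j))"
  proof (rule P.PiM_eqI)
    show "finite ?T" by (rule finite_tidx)
    show "sets (density (obs_law d n (\<lambda>_. 0)) (\<lambda>y. ennreal (likelihood ?T X y)))
      = sets (PiM ?T (\<lambda>j. ?N (X j)))"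
      by (simp add: sets_obs_law) (intro sets_PiM_cong; simp)
    fix A assume A: "\<And>i. i \<in> ?T \<Longrightarrow> A i \<in> sets (?N (X i))"
    have PA: "PiE ?T A \<in> sets (obs_law d n (\<lambda>_. 0))"
      unfolding sets_obs_law using A finite_tidx by (intro sets_PiM_I_finite) auto
    let ?g = "\<lambda>x y. ennreal (exp (X x * y - (X x)\<^sup>2 / 2)) * indicator (A x) y"
    have "emeasure (density (obs_law d n (\<lambda>_. 0)) (\<lambda>y. ennreal (likelihood ?T X y))) (PiE ?T A)
      = (\<integral>\<^sup>+ y. ennreal (likelihood ?T X y) * indicator (PiE ?T A) y \<partial>obs_law d n (\<lambda>_. 0))"
      using PA likelihood_measurable_obs_law by (subst emeasure_density) auto
    also have "\<dots> = (\<integral>\<^sup>+ y. (\<Prod>x\<in>?T. ?g x (y x)) \<partial>obs_law d n (\<lambda>_. 0))"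
    proof (rule nn_integral_cong)
      fix y assume "y \<in> space (obs_law d n (\<lambda>_. 0))"
      then have y: "y \<in> extensional ?T"
        by (auto simp: space_obs_law space_PiM PiE_def)
      \<comment> \<open>Sample points are extensional, so membership in the box is decided cell by
        cell.\<close>
      have "indicator (PiE ?T A) y = (\<Prod>x\<in>?T. indicator (A x) (y x) :: ennreal)"
        using y finite_tidx[of d n]
        by (auto simp: indicator_def PiE_def Pi_def prod_eq_1_iff prod_zero_iff)
      moreover have "ennreal (likelihood ?T X y) = (\<Prod>x\<in>?T. ennreal (exp (X x * y x - (X x)\<^sup>2 / 2)))"
        by (simp add: likelihood_def exp_sum finite_tidx prod_ennreal)
      ultimately show "ennreal (likelihood ?T X y) * indicator (PiE ?T A) y = (\<Prod>x\<in>?T. ?g x (y x))"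
        by (simp add: prod.distrib)
    qed
    also have "\<dots> = (\<Prod>x\<in>?T. \<integral>\<^sup>+ y. ?g x y \<partial>?N 0)"
      unfolding obs_law_def using A
      by (intro Q.product_nn_integral_prod finite_tidx)
         (auto intro!: borel_measurable_times_ennreal borel_measurable_indicator)
    also have "\<dots> = (\<Prod>x\<in>?T. emeasure (?N (X x)) (A x))"
    proof (rule prod.cong[OF refl])
      fix x assume x: "x \<in> ?T"
      have [measurable]: "A x \<in> sets borel" using A[OF x] by simp
      have "(\<integral>\<^sup>+ y. ?g x y \<partial>?N 0) = (\<integral>\<^sup>+ y. ennreal (normal_density 0 1 y) * ?g x y \<partial>lborel)"
        by (subst nn_integral_density) auto
      also have "\<dots> = (\<integral>\<^sup>+ y. ennreal (normal_density (X x) 1 y) * indicator (A x) y \<partial>lborel)"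
        by (intro nn_integral_cong, subst (2) normal_density_shift)
           (auto simp: ennreal_mult indicator_def mult.commute)
      also have "\<dots> = emeasure (?N (X x)) (A x)"
        by (subst emeasure_density) auto
      finally show "(\<integral>\<^sup>+ y. ?g x y \<partial>?N 0) = emeasure (?N (X x)) (A x)" .
    qed
    finally show "emeasure (density (obs_law d n (\<lambda>_. 0)) (\<lambda>y. ennreal (likelihood ?T X y))) (PiE ?T A)
      = (\<Prod>x\<in>?T. emeasure (?N (X x)) (A x))" .
  qed
  then show ?thesis unfolding obs_law_def by simp
qed

text \<open>The integral is the total mass of the probability law with mean
  \<open>c\<close>.\<close>

lemma likelihood_expectation:
  shows likelihood_integrable: "integrable (obs_law d n (\<lambda>_. 0)) (likelihood (tidx d n) c)"
    and likelihood_integral: "(\<integral>y. likelihood (tidx d n) c y \<partial>obs_law d n (\<lambda>_. 0)) = 1"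
proof -
  interpret P: prob_space "obs_law d n c" by (rule prob_space_obs_law)
  have "(\<integral>\<^sup>+ y. ennreal (likelihood (tidx d n) c y) \<partial>obs_law d n (\<lambda>_. 0)) = emeasure (obs_law d n c) (space (obs_law d n c))"
    by (subst (1 2) obs_law_density[of d n c], subst emeasure_density)
       (auto intro: measurable_compose[OF likelihood_measurable_obs_law measurable_ennreal] simp: sets.top[of "obs_law d n (\<lambda>_. 0)"] intro!: nn_integral_cong)
  also have "\<dots> = 1" by (rule P.emeasure_space_1)
  finally have "has_bochner_integral (obs_law d n (\<lambda>_. 0)) (likelihood (tidx d n) c) 1"
    by (intro has_bochner_integral_nn_integral likelihood_measurable_obs_law) (auto simp: likelihood_def)
  then show "integrable (obs_law d n (\<lambda>_. 0)) (likelihood (tidx d n) c)"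
    "(\<integral>y. likelihood (tidx d n) c y \<partial>obs_law d n (\<lambda>_. 0)) = 1"
    by (auto simp: has_bochner_integral_iff)
qed

lemma obs_law_measure:
  assumes "A \<in> sets (obs_law d n (\<lambda>_. 0))"
  shows "measure (obs_law d n X) A
    = (\<integral>y. likelihood (tidx d n) X y * indicator A y \<partial>obs_law d n (\<lambda>_. 0))"
proof -
  have "measure (obs_law d n X) A = (\<integral>y. indicator A y \<partial>obs_law d n X)"
    using assms by (simp add: sets_obs_law)
  also have "\<dots> = (\<integral>y. likelihood (tidx d n) X y * indicator A y \<partial>obs_law d n (\<lambda>_. 0))"
    by (subst obs_law_density, subst integral_real_density)
       (use assms likelihood_measurable_obs_law in \<open>auto simp: likelihood_def\<close>)
  finally show ?thesis .
qed

text \<open>The Gaussian moment generating function: up to a constant factor the integrand is itself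
  a likelihood, which integrates to 1.\<close>

lemma exp_linear_expectation:
  fixes c :: "nat list \<Rightarrow> real" and a :: real
  shows exp_linear_integrable: "integrable (obs_law d n (\<lambda>_. 0)) (\<lambda>y. exp (a + (\<Sum>x\<in>tidx d n. c x * y x)))"
    and exp_linear_integral:
      "(\<integral>y. exp (a + (\<Sum>x\<in>tidx d n. c x * y x)) \<partial>obs_law d n (\<lambda>_. 0)) = exp (a + (\<Sum>x\<in>tidx d n. (c x)\<^sup>2 / 2))"
proof -
  have eq: "exp (a + (\<Sum>x\<in>tidx d n. c x * y x))
    = exp (a + (\<Sum>x\<in>tidx d n. (c x)\<^sup>2 / 2)) * likelihood (tidx d n) c y" for y
    by (simp add: likelihood_def exp_add[symmetric] sum_subtractf)
  show "integrable (obs_law d n (\<lambda>_. 0)) (\<lambda>y. exp (a + (\<Sum>x\<in>tidx d n. c x * y x)))"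
    unfolding eq by (intro integrable_mult_right likelihood_integrable)
  show "(\<integral>y. exp (a + (\<Sum>x\<in>tidx d n. c x * y x)) \<partial>obs_law d n (\<lambda>_. 0)) = exp (a + (\<Sum>x\<in>tidx d n. (c x)\<^sup>2 / 2))"
    unfolding eq by (subst integral_mult_right_zero) (simp add: likelihood_integral)
qed

text \<open>Here \<open>A\<close> is the rejection region, \<open>L\<close> the likelihood ratios
  and \<open>l\<close> their truncations. For the mixture \<open>m\<close> of the
  \<open>l i\<close>, the second moment of \<open>m - 1\<close> is at most
  \<open>Q - 2 * (1 - p) + 1\<close>, so Cauchy-Schwarz bounds the mean of
  \<open>\<bar>m - 1\<bar>\<close> by the square root. Only a lower bound on the mass of
  \<open>l i\<close> is needed, so truncation costs \<open>2 * p\<close> under the root.\<close>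

lemma (in prob_space) truncated_second_moment:
  fixes L l :: "'i \<Rightarrow> 'a \<Rightarrow> real"
    and p Q :: real
  assumes fin: "finite F" and ne: "F \<noteq> {}" and A: "A \<in> events"
    and intL: "\<And>i. i \<in> F \<Longrightarrow> integrable M (L i)"
    and intl: "\<And>i. i \<in> F \<Longrightarrow> integrable M (l i)"
    and bounds: "\<And>i y. i \<in> F \<Longrightarrow> 0 \<le> l i y \<and> l i y \<le> L i y"
    and int2: "\<And>i j. i \<in> F \<Longrightarrow> j \<in> F \<Longrightarrow> integrable M (\<lambda>y. l i y * l j y)"
    and lower: "\<And>i. i \<in> F \<Longrightarrow> 1 - p \<le> expectation (l i)"
    and upper: "\<And>i. i \<in> F \<Longrightarrow> (\<Sum>j\<in>F. expectation (\<lambda>y. l i y * l j y)) \<le> Q * card F"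
  shows "1 - sqrt (Q - 1 + 2 * p)
    \<le> prob A + (\<Sum>i\<in>F. expectation (\<lambda>y. L i y * indicator (space M - A) y)) / card F"
proof -
  define N where "N = real (card F)"
  have N: "N > 0" using fin ne by (simp add: N_def card_gt_0_iff)
  define m where "m = (\<lambda>y. (\<Sum>i\<in>F. l i y) / N)"
  have int_m: "integrable M m"
    unfolding m_def by (intro integrable_divide Bochner_Integration.integrable_sum intl)
  have m0: "0 \<le> m y" for y
    unfolding m_def using bounds N by (intro divide_nonneg_pos sum_nonneg) auto
  have m_sq: "(m y)\<^sup>2 = (\<Sum>i\<in>F. \<Sum>j\<in>F. l i y * l j y) / N\<^sup>2" for y
    by (simp add: m_def power_divide power2_eq_square sum_product)
  have int_m2: "integrable M (\<lambda>y. (m y)\<^sup>2)"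
    unfolding m_sq by (intro integrable_divide Bochner_Integration.integrable_sum int2)
  have "expectation (\<lambda>y. (m y)\<^sup>2) = (\<Sum>i\<in>F. \<Sum>j\<in>F. expectation (\<lambda>y. l i y * l j y)) / N\<^sup>2"
    unfolding m_sq using int2 by (simp add: Bochner_Integration.integral_sum)
  also have "\<dots> \<le> (\<Sum>i\<in>F. Q * N) / N\<^sup>2"
    using upper by (intro divide_right_mono sum_mono) (auto simp: N_def)
  also have "\<dots> = Q" using N by (simp add: N_def power2_eq_square)
  finally have E2: "expectation (\<lambda>y. (m y)\<^sup>2) \<le> Q" .
  have "1 - p = (\<Sum>i\<in>F. 1 - p) / N" using N by (simp add: N_def)
  also have "\<dots> \<le> (\<Sum>i\<in>F. expectation (l i)) / N"
    using lower N by (intro divide_right_mono sum_mono) auto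
  also have "\<dots> = expectation m"
    unfolding m_def using intl by (simp add: Bochner_Integration.integral_sum)
  finally have E1: "1 - p \<le> expectation m" .
  define g where "g = (\<lambda>y. \<bar>m y - 1\<bar>)"
  have int_g: "integrable M g"
    unfolding g_def using int_m by auto
  have g_sq: "(g y)\<^sup>2 = (m y)\<^sup>2 - 2 * m y + 1" for y
    by (simp add: g_def power2_eq_square algebra_simps)
  have int_g2: "integrable M (\<lambda>y. (g y)\<^sup>2)"
    unfolding g_sq using int_m int_m2 by simp
  \<comment> \<open>Cauchy-Schwarz in the form that the variance of \<open>g\<close> is
    nonnegative.\<close>
  have "(expectation g)\<^sup>2 \<le> expectation (\<lambda>y. (g y)\<^sup>2)"
    using variance_positive[of g] variance_eq[OF int_g int_g2] by simp
  also have "\<dots> = expectation (\<lambda>y. (m y)\<^sup>2) - 2 * expectation m + 1"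
    unfolding g_sq using int_m int_m2 by (simp add: prob_space)
  also have "\<dots> \<le> Q - 1 + 2 * p" using E1 E2 by linarith
  finally have Eg: "expectation g \<le> sqrt (Q - 1 + 2 * p)" by (rule real_le_rsqrt)
  have int_mA: "integrable M (\<lambda>y. m y * indicator (space M - A) y)"
    using int_m A by (intro integrable_real_mult_indicator) auto
  have int_A: "integrable M (\<lambda>y. indicator A y :: real)"
    using A by (simp add: emeasure_eq_measure)
  have int_LA: "integrable M (\<lambda>y. L i y * indicator (space M - A) y)"
    and int_lA: "integrable M (\<lambda>y. l i y * indicator (space M - A) y)" if "i \<in> F" for i
    using A by (auto intro!: integrable_real_mult_indicator intL intl that)
  have "1 - expectation g = expectation (\<lambda>y. 1 - g y)"
    using int_g by (simp add: prob_space)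
  \<comment> \<open>Pointwise, \<open>1 - \<bar>m y - 1\<bar>\<close> is at most 1, which serves on
    \<open>A\<close>, and at most \<open>m y\<close>, which serves off \<open>A\<close>.\<close>
  also have "\<dots> \<le> expectation (\<lambda>y. indicator A y + m y * indicator (space M - A) y)"
  proof (rule integral_mono)
    show "integrable M (\<lambda>y. 1 - g y)" using int_g by simp
    show "integrable M (\<lambda>y. indicator A y + m y * indicator (space M - A) y)"
      using int_A int_mA by simp
    fix y assume "y \<in> space M"
    then show "1 - g y \<le> indicator A y + m y * indicator (space M - A) y"
      using m0[of y] by (auto simp: g_def indicator_def)
  qed
  also have "\<dots> = prob A + expectation (\<lambda>y. m y * indicator (space M - A) y)"
    using int_A int_mA A by simp
  also have "expectation (\<lambda>y. m y * indicator (space M - A) y)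
    = (\<Sum>i\<in>F. expectation (\<lambda>y. l i y * indicator (space M - A) y)) / N"
    unfolding m_def times_divide_eq_left sum_distrib_right using int_lA
    by (simp add: Bochner_Integration.integral_sum)
  \<comment> \<open>The truncation is undone here: \<open>l \<le> L\<close>, so the error of the
    second kind only grows.\<close>
  also have "\<dots> \<le> (\<Sum>i\<in>F. expectation (\<lambda>y. L i y * indicator (space M - A) y)) / N"
    using N bounds int_LA int_lA
    by (intro divide_right_mono sum_mono integral_mono) (auto simp: indicator_def)
  finally show ?thesis using Eg unfolding N_def by linarith
qed

section \<open>Blocks as supports of planted tensors\<close>

definition block :: "nat \<Rightarrow> (nat \<Rightarrow> nat set) \<Rightarrow> nat list set" where
  "block d I = {x. length x = d \<and> (\<forall>i<d. x ! i \<in> I i)}"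

lemma card_block: "card (block d I) = (\<Prod>i<d. card (I i))"
proof -
  let ?f = "\<lambda>f. map f [0..<d]"
  have "inj_on ?f (PiE {..<d} I)"
  proof (rule inj_onI)
    fix f g assume f: "f \<in> PiE {..<d} I" "g \<in> PiE {..<d} I" "?f f = ?f g"
    show "f = g"
    proof (rule PiE_ext[OF f(1,2)])
      fix i assume "i \<in> {..<d}"
      then show "f i = g i" using f(3) by (simp add: map_eq_conv)
    qed
  qed
  moreover have "?f ` PiE {..<d} I = block d I"
  proof (rule equalityI; rule subsetI)
    fix x assume "x \<in> ?f ` PiE {..<d} I"
    then obtain f where "f \<in> PiE {..<d} I" "x = ?f f" by (rule imageE)
    then show "x \<in> block d I" by (simp add: block_def PiE_iff)
  next
    fix x assume x: "x \<in> block d I"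
    let ?g = "restrict ((!) x) {..<d}"
    have "x = ?f ?g" using x by (intro nth_equalityI) (simp_all add: block_def)
    moreover have "?g \<in> PiE {..<d} I" using x by (simp add: block_def)
    ultimately show "x \<in> ?f ` PiE {..<d} I" by (rule image_eqI)
  qed
  ultimately have "card (block d I) = card (PiE {..<d} I)" by (metis card_image)
  then show ?thesis by (simp add: card_PiE)
qed

lemma block_subset_tidx: "(\<And>i. i < d \<Longrightarrow> I i \<subseteq> {..<n i}) \<Longrightarrow> block d I \<subseteq> tidx d n"
  by (auto simp: block_def tidx_def)

lemma block_mono: "(\<And>i. i < d \<Longrightarrow> J i \<subseteq> I i) \<Longrightarrow> block d J \<subseteq> block d I"
  by (auto simp: block_def)

lemma block_Int: "block d I \<inter> block d J = block d (\<lambda>i. I i \<inter> J i)"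
  by (auto simp: block_def)

lemma block_restrict: "block d (restrict I {..<d}) = block d I"
  by (auto simp: block_def)

lemma chc_tensor_eq:
  assumes "x \<in> tidx d n"
  shows "chc_tensor d lam I x = lam * indicator (block d I) x"
proof -
  have "(\<Prod>i<d. indicator (I i) (x ! i)) = (indicator (block d I) x :: real)"
    using assms by (auto simp: indicator_def block_def tidx_def prod_eq_1_iff)
  then show ?thesis by (simp add: chc_tensor_def)
qed

lemma sum_indicator_subset:
  fixes f :: "'a \<Rightarrow> real"
  assumes "finite T" "V \<subseteq> T"
  shows "(\<Sum>x\<in>T. indicator V x * f x) = sum f V"
  using assms by (intro sum.mono_neutral_cong_right) (auto simp: indicator_def)

lemma sum_indicator_square:
  fixes a b :: real
  assumes "finite T" "S \<subseteq> T" "V \<subseteq> T"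
  shows "(\<Sum>x\<in>T. (a * indicator S x + b * indicator V x)\<^sup>2 / 2)
    = a\<^sup>2 / 2 * card S + a * b * card (S \<inter> V) + b\<^sup>2 / 2 * card V"
proof -
  have "(\<Sum>x\<in>T. (a * indicator S x + b * indicator V x)\<^sup>2 / 2)
    = (\<Sum>x\<in>T. indicator S x * (a\<^sup>2 / 2) + indicator (S \<inter> V) x * (a * b) + indicator V x * (b\<^sup>2 / 2))"
    by (intro sum.cong refl) (simp add: indicator_def power2_eq_square field_simps)
  also have "\<dots> = a\<^sup>2 / 2 * card S + a * b * card (S \<inter> V) + b\<^sup>2 / 2 * card V"
    using assms sum_indicator_subset[of T S "\<lambda>_. a\<^sup>2 / 2"]
      sum_indicator_subset[of T "S \<inter> V" "\<lambda>_. a * b"] sum_indicator_subset[of T V "\<lambda>_. b\<^sup>2 / 2"]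
    by (simp only: sum.distrib) (simp add: le_infI1 mult.commute)
  finally show ?thesis .
qed

section \<open>Gaussian integrals over blocks\<close>

locale gaussian_tensor =
  fixes d :: nat and n :: "nat \<Rightarrow> nat" and lam :: real
begin

abbreviation (input) "T \<equiv> tidx d n"
abbreviation (input) "P0 \<equiv> obs_law d n (\<lambda>_. 0)"
abbreviation (input) "LR S \<equiv> likelihood T (\<lambda>x. lam * indicator S x)"

lemma LR_eq:
  assumes "S \<subseteq> T"
  shows "LR S y = exp (lam * sum y S - lam\<^sup>2 / 2 * card S)"
proof -
  have "(\<Sum>x\<in>T. lam * indicator S x * y x - (lam * indicator S x)\<^sup>2 / 2)
    = (\<Sum>x\<in>T. indicator S x * (lam * y x - lam\<^sup>2 / 2))"
    by (intro sum.cong) (auto simp: indicator_def)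
  also have "\<dots> = lam * sum y S - lam\<^sup>2 / 2 * card S"
    using assms by (subst sum_indicator_subset) (auto simp: finite_tidx sum_subtractf sum_distrib_left)
  finally show ?thesis by (simp add: likelihood_def)
qed

text \<open>The block sums over \<open>S\<close> and \<open>V\<close> are jointly Gaussian with
  variances \<open>card S\<close>, \<open>card V\<close> and covariance
  \<open>card (S \<inter> V)\<close>. The exponent on the right is \<open>u\<close> plus half the
  variance of the linear combination.\<close>

lemma exp_two_blocks:
  assumes "S \<subseteq> T" "V \<subseteq> T"
  shows exp_two_blocks_integrable: "integrable P0 (\<lambda>y. exp (u + a * sum y S + b * sum y V))"
    and exp_two_blocks_integral: "(\<integral>y. exp (u + a * sum y S + b * sum y V) \<partial>P0)
      = exp (u + a\<^sup>2 / 2 * card S + a * b * card (S \<inter> V) + b\<^sup>2 / 2 * card V)"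
proof -
  have eq: "exp (u + a * sum y S + b * sum y V)
    = exp (u + (\<Sum>x\<in>T. (a * indicator S x + b * indicator V x) * y x))" for y
    unfolding distrib_right sum.distrib mult.assoc sum_distrib_left[symmetric]
      sum_indicator_subset[OF finite_tidx assms(1)] sum_indicator_subset[OF finite_tidx assms(2)]
    by (simp only: add.assoc)
  show "integrable P0 (\<lambda>y. exp (u + a * sum y S + b * sum y V))"
    unfolding eq by (rule exp_linear_integrable)
  show "(\<integral>y. exp (u + a * sum y S + b * sum y V) \<partial>P0)
      = exp (u + a\<^sup>2 / 2 * card S + a * b * card (S \<inter> V) + b\<^sup>2 / 2 * card V)"
    unfolding eq exp_linear_integral using assms
    by (subst sum_indicator_square) (auto simp: finite_tidx add.assoc)
qed

lemma LR_nonneg: "0 \<le> LR S y"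
  by (simp add: likelihood_def)

lemma LR_product:
  assumes "S \<subseteq> T" "S' \<subseteq> T"
  shows LR_product_integrable: "integrable P0 (\<lambda>y. LR S y * LR S' y)"
    and LR_product_integral: "(\<integral>y. LR S y * LR S' y \<partial>P0) = exp (lam\<^sup>2 * card (S \<inter> S'))"
proof -
  have eq: "LR S y * LR S' y
    = exp (- (lam\<^sup>2 / 2 * card S + lam\<^sup>2 / 2 * card S') + lam * sum y S + lam * sum y S')" for y
    using assms by (simp add: LR_eq exp_add[symmetric])
  show "integrable P0 (\<lambda>y. LR S y * LR S' y)"
    unfolding eq using assms by (rule exp_two_blocks_integrable)
  show "(\<integral>y. LR S y * LR S' y \<partial>P0) = exp (lam\<^sup>2 * card (S \<inter> S'))"
    unfolding eq using assms by (subst exp_two_blocks_integral) (auto simp: power2_eq_square)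
qed

lemma sum_measurable_P0:
  assumes "V \<subseteq> T"
  shows "(\<lambda>y. sum y V) \<in> borel_measurable P0"
  unfolding measurable_cong_sets[OF sets_obs_law refl]
  using assms by (intro borel_measurable_sum measurable_component_singleton) auto

lemma sets_sum_less: "V \<subseteq> T \<Longrightarrow> {y \<in> space P0. c < sum y V} \<in> sets P0"
  by (intro borel_measurable_less borel_measurable_const sum_measurable_P0)

lemma sets_sum_le: "V \<subseteq> T \<Longrightarrow> {y \<in> space P0. sum y V \<le> c} \<in> sets P0"
  by (intro borel_measurable_le borel_measurable_const sum_measurable_P0)

text \<open>Weighting by \<open>LR S\<close> shifts the mean of the sum over \<open>V\<close> to
  \<open>lam * card V\<close> and keeps its variance \<open>card V\<close>. The deviation
  \<open>sqrt (2 * card V * E)\<close> is the one whose Chernoff bound is exactly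
  \<open>exp (- E)\<close>.\<close>

lemma LR_tail:
  fixes E :: real
  assumes "V \<subseteq> S" "S \<subseteq> T" "E \<ge> 0"
  shows "(\<integral>y. LR S y * indicator {y. lam * card V + sqrt (2 * card V * E) < sum y V} y \<partial>P0) \<le> exp (- E)"
    (is "?I \<le> _")
proof (cases "card V = 0")
  case True
  have "finite V" using assms finite_tidx by (meson finite_subset)
  then have "V = {}" using True by simp
  then show ?thesis by simp
next
  case False
  define v where "v = real (card V)"
  have v: "v > 0" using False by (simp add: v_def)
  define \<tau> where "\<tau> = sqrt (2 * v * E)"
  \<comment> \<open>The optimal Chernoff parameter, deviation over variance:
    \<open>\<tau> / v\<close>.\<close>
  define \<nu> where "\<nu> = sqrt (2 * E / v)"
  have \<nu>0: "\<nu> \<ge> 0" using assms v by (simp add: \<nu>_def)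
  have \<tau>: "\<tau> = \<nu> * v"
  proof -
    have "\<nu> * v = sqrt (2 * E / v) * sqrt (v\<^sup>2)" using v by (simp add: \<nu>_def)
    also have "\<dots> = \<tau>" using v unfolding \<tau>_def real_sqrt_mult[symmetric] by (simp add: power2_eq_square field_simps)
    finally show ?thesis ..
  qed
  have \<nu>2: "\<nu>\<^sup>2 * v = 2 * E" using v assms by (simp add: \<nu>_def)
  have VT: "V \<subseteq> T" using assms by blast
  define u where "u = - (lam\<^sup>2 / 2 * card S) - \<nu> * (lam * v + \<tau>)"
  have "?I \<le> (\<integral>y. exp (u + lam * sum y S + \<nu> * sum y V) \<partial>P0)"
  proof (rule integral_mono_AE')
    show "integrable P0 (\<lambda>y. exp (u + lam * sum y S + \<nu> * sum y V))"
      using assms(2) VT by (rule exp_two_blocks_integrable)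
    show "AE y in P0. LR S y * indicator {y. lam * card V + sqrt (2 * card V * E) < sum y V} y
        \<le> exp (u + lam * sum y S + \<nu> * sum y V)"
    proof (rule AE_I2)
      fix y
      show "LR S y * indicator {y. lam * card V + sqrt (2 * card V * E) < sum y V} y
        \<le> exp (u + lam * sum y S + \<nu> * sum y V)"
      proof (cases "lam * v + \<tau> < sum y V")
        case True
        then have "\<nu> * (lam * v + \<tau>) \<le> \<nu> * sum y V" using \<nu>0 by (intro mult_left_mono) auto
        then have "lam * sum y S - lam\<^sup>2 / 2 * card S \<le> u + lam * sum y S + \<nu> * sum y V"
          by (simp add: u_def)
        then show ?thesis unfolding LR_eq[OF assms(2)] by (simp add: indicator_def)
      next
        case False
        then show ?thesis by (simp add: indicator_def v_def \<tau>_def)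
      qed
    qed
    show "AE y in P0. 0 \<le> exp (u + lam * sum y S + \<nu> * sum y V)" by simp
  qed
  also have "\<dots> = exp (u + lam\<^sup>2 / 2 * card S + lam * \<nu> * card (S \<inter> V) + \<nu>\<^sup>2 / 2 * card V)"
    using assms(2) VT by (rule exp_two_blocks_integral)
  also have "u + lam\<^sup>2 / 2 * card S + lam * \<nu> * card (S \<inter> V) + \<nu>\<^sup>2 / 2 * card V = - E"
  proof -
    have "S \<inter> V = V" using assms by blast
    then show ?thesis using \<nu>2 unfolding u_def \<tau> v_def
      by (simp add: algebra_simps power2_eq_square)
  qed
  finally show ?thesis .
qed

text \<open>The indicator is bounded by \<open>exp (\<lambda> (\<lambda> |U| + \<tau> - Y\<^sub>U))\<close> with \<open>U = S \<inter> S'\<close>; this choice of the Chernoff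
parameter turns \<open>Y\<^sub>S + Y\<^sub>S\<^sub>' - Y\<^sub>U\<close> into the sum over \<open>S \<union> S'\<close>.\<close>
lemma LR_product_truncated:
  assumes "S \<subseteq> T" "S' \<subseteq> T" "lam \<ge> 0"
  shows "(\<integral>y. LR S y * LR S' y * indicator {y. sum y (S \<inter> S') \<le> lam * card (S \<inter> S') + \<tau>} y \<partial>P0)
    \<le> exp (lam\<^sup>2 * card (S \<inter> S') / 2 + lam * \<tau>)" (is "?I \<le> _")
proof -
  define U where "U = S \<inter> S'"
  have fin: "finite S" "finite S'" using assms finite_tidx by (auto intro: finite_subset)
  define u where "u = - (lam\<^sup>2 / 2 * (card S + card S')) + lam * (lam * card U + \<tau>)"
  have sum_Un: "sum y (S \<union> S') = sum y S + sum y S' - sum y U" for y :: "nat list \<Rightarrow> real"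
    unfolding U_def using fin by (rule sum.union_inter[of S S' y, THEN eq_diff_eq[THEN iffD2]])
  have card_Un: "real (card (S \<union> S')) = real (card S) + real (card S') - real (card U)"
    using card_Un_Int[OF fin] unfolding U_def by linarith
  \<comment> \<open>The empty second block puts the integrand into the form of
    \<open>exp_two_blocks\<close>.\<close>
  have "?I \<le> (\<integral>y. exp (u + lam * sum y (S \<union> S') + 0 * sum y {}) \<partial>P0)"
  proof (rule integral_mono_AE')
    show "integrable P0 (\<lambda>y. exp (u + lam * sum y (S \<union> S') + 0 * sum y {}))"
      using assms by (intro exp_two_blocks_integrable) auto
    show "AE y in P0. LR S y * LR S' y * indicator {y. sum y (S \<inter> S') \<le> lam * card (S \<inter> S') + \<tau>} y
        \<le> exp (u + lam * sum y (S \<union> S') + 0 * sum y {})"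
    proof (rule AE_I2)
      fix y
      show "LR S y * LR S' y * indicator {y. sum y (S \<inter> S') \<le> lam * card (S \<inter> S') + \<tau>} y
        \<le> exp (u + lam * sum y (S \<union> S') + 0 * sum y {})"
      proof (cases "sum y U \<le> lam * card U + \<tau>")
        case True
        then have "lam * sum y U \<le> lam * (lam * card U + \<tau>)" using assms by (intro mult_left_mono) auto
        then have "lam * sum y S - lam\<^sup>2 / 2 * card S + (lam * sum y S' - lam\<^sup>2 / 2 * card S')
          \<le> u + lam * sum y (S \<union> S')"
          unfolding u_def sum_Un by (simp add: field_simps)
        then show ?thesis unfolding LR_eq[OF assms(1)] LR_eq[OF assms(2)]
          by (simp add: indicator_def exp_add[symmetric])
      next
        case False
        then show ?thesis by (simp add: indicator_def U_def)
      qed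
    qed
    show "AE y in P0. 0 \<le> exp (u + lam * sum y (S \<union> S') + 0 * sum y {})" by simp
  qed
  also have "\<dots> = exp (u + lam\<^sup>2 / 2 * card (S \<union> S') + lam * 0 * card ((S \<union> S') \<inter> {}) + 0\<^sup>2 / 2 * card ({} :: nat list set))"
    using assms by (intro exp_two_blocks_integral) auto
  also have "u + lam\<^sup>2 / 2 * card (S \<union> S') + lam * 0 * card ((S \<union> S') \<inter> {}) + 0\<^sup>2 / 2 * card ({} :: nat list set)
    = lam\<^sup>2 * card U / 2 + lam * \<tau>"
    unfolding card_Un u_def by (simp add: field_simps power2_eq_square)
  finally show ?thesis unfolding U_def .
qed

end

section \<open>Overlap of random subsets\<close>

text \<open>A fixed \<open>h\<close>-set lies in a uniform \<open>k\<close>-set with probability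
  equal to the product of \<open>(k - i) / (n - i)\<close> over \<open>i < h\<close>, and each
  factor is at most \<open>k / n\<close>. The multiplied form avoids division by zero.\<close>

lemma divide_binomial_le:
  assumes "h \<le> k" "k \<le> n"
  shows "real ((n - h) choose (k - h)) * (real n) ^ h \<le> real (n choose k) * (real k) ^ h"
  using assms(1)
proof (induction h)
  case 0
  then show ?case by simp
next
  case (Suc h)
  then have hk: "h < k" by simp
  define a where "a = n - h"
  define b where "b = k - h"
  have ab: "0 < b" "b \<le> a" using hk assms by (auto simp: a_def b_def)
  \<comment> \<open>The absorption identity peels off one factor \<open>b / a\<close> of that
    product.\<close>
  have "Suc (b - 1) * (Suc (a - 1) choose Suc (b - 1)) = Suc (a - 1) * ((a - 1) choose (b - 1))"
    by (rule Suc_times_binomial)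
  then have 1: "real b * real (a choose b) = real a * real ((a - 1) choose (b - 1))"
    using ab by (metis Suc_pred' less_le_trans of_nat_mult)
  have 2: "real b * real n \<le> real k * real a"
    using hk assms unfolding a_def b_def
    by (simp add: of_nat_diff algebra_simps mult_left_mono)
  have "real a * (real ((a - 1) choose (b - 1)) * real n) = (real b * real n) * real (a choose b)"
    using 1 by (simp add: mult.commute mult.left_commute)
  also have "\<dots> \<le> (real k * real a) * real (a choose b)"
    using 2 by (intro mult_right_mono) auto
  finally have "real ((a - 1) choose (b - 1)) * real n \<le> real k * real (a choose b)"
    using ab by (simp add: mult.assoc mult.left_commute)
  then have "real ((n - Suc h) choose (k - Suc h)) * real n \<le> real k * real ((n - h) choose (k - h))"
    by (simp add: a_def b_def)
  then have "real ((n - Suc h) choose (k - Suc h)) * real n * real n ^ h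
      \<le> real k * real ((n - h) choose (k - h)) * real n ^ h"
    by (rule mult_right_mono) simp
  also have "\<dots> \<le> real k * (real (n choose k) * real k ^ h)"
    unfolding mult.assoc using Suc hk by (intro mult_left_mono) auto
  finally show ?case by (simp add: algebra_simps)
qed

definition ksubsets :: "nat \<Rightarrow> nat \<Rightarrow> nat set set" where
  "ksubsets n k = {I. I \<subseteq> {..<n} \<and> card I = k}"

lemma finite_ksubsets: "finite (ksubsets n k)"
  unfolding ksubsets_def by (rule finite_subset[of _ "Pow {..<n}"]) auto

lemma card_ksubsets: "card (ksubsets n k) = n choose k"
  unfolding ksubsets_def using n_subsets[of "{..<n}" k] by simp

lemma card_ksubsets_superset:
  assumes "J \<subseteq> {..<n}" "card J = h" "h \<le> k"
  shows "card {I \<in> ksubsets n k. J \<subseteq> I} = (n - h) choose (k - h)"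
proof -
  have finJ: "finite J" using assms by (meson finite_lessThan finite_subset)
  have "bij_betw (\<lambda>I. I - J) {I \<in> ksubsets n k. J \<subseteq> I} {I. I \<subseteq> {..<n} - J \<and> card I = k - h}"
  proof (rule bij_betw_byWitness[where f' = "\<lambda>I. I \<union> J"])
    show "(\<lambda>I. I - J) ` {I \<in> ksubsets n k. J \<subseteq> I} \<subseteq> {I. I \<subseteq> {..<n} - J \<and> card I = k - h}"
      using finJ assms by (auto simp: ksubsets_def card_Diff_subset)
    show "(\<lambda>I. I \<union> J) ` {I. I \<subseteq> {..<n} - J \<and> card I = k - h} \<subseteq> {I \<in> ksubsets n k. J \<subseteq> I}"
    proof clarsimp
      fix I assume I: "I \<subseteq> {..<n} - J" "card I = k - h"
      then have "card (I \<union> J) = card I + card J"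
        using finJ by (intro card_Un_disjoint) (auto dest: finite_subset)
      then show "I \<union> J \<in> ksubsets n k" using I assms by (auto simp: ksubsets_def)
    qed
  qed auto
  then have "card {I \<in> ksubsets n k. J \<subseteq> I} = card {I. I \<subseteq> {..<n} - J \<and> card I = k - h}"
    by (rule bij_betw_same_card)
  also have "\<dots> = card ({..<n} - J) choose (k - h)" by (rule n_subsets) simp
  also have "card ({..<n} - J) = n - h" using assms finJ by (simp add: card_Diff_subset)
  finally show ?thesis .
qed

text \<open>A union bound over the \<open>k choose h\<close> candidates \<open>V\<close> for the
  intersection. For each, the event that the intersection equals \<open>V\<close> is enlarged to
  \<open>V \<subseteq> J\<close>, whose probability \<open>divide_binomial_le\<close>
  bounds.\<close>

lemma card_ksubsets_overlap:
  assumes "I \<in> ksubsets n k" "h \<le> k" "k \<le> n"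
  shows "real (card {J \<in> ksubsets n k. card (I \<inter> J) = h})
    \<le> real (card (ksubsets n k)) * (real (k choose h) * (real k / real n) ^ h)"
proof (cases "n = 0")
  case True
  have "card {J \<in> ksubsets n k. card (I \<inter> J) = h} \<le> card (ksubsets n k)"
    by (intro card_mono finite_ksubsets) auto
  moreover have "k = 0" "h = 0" using assms True by auto
  ultimately show ?thesis by simp
next
  case False
  have I: "I \<subseteq> {..<n}" "card I = k" using assms(1) by (simp_all add: ksubsets_def)
  have finI: "finite I" by (rule finite_subset[OF I(1)]) simp
  let ?S = "{V. V \<subseteq> I \<and> card V = h}"
  have finS: "finite ?S" by (rule finite_subset[of _ "Pow I"]) (use finI in auto)
  have "{J \<in> ksubsets n k. card (I \<inter> J) = h} \<subseteq> (\<Union>V\<in>?S. {J \<in> ksubsets n k. V \<subseteq> J})"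
  proof
    fix J assume "J \<in> {J \<in> ksubsets n k. card (I \<inter> J) = h}"
    then have "I \<inter> J \<in> ?S" "J \<in> {J' \<in> ksubsets n k. I \<inter> J \<subseteq> J'}" by simp_all
    then show "J \<in> (\<Union>V\<in>?S. {J \<in> ksubsets n k. V \<subseteq> J})" by (rule UN_I)
  qed
  then have "card {J \<in> ksubsets n k. card (I \<inter> J) = h} \<le> card (\<Union>V\<in>?S. {J \<in> ksubsets n k. V \<subseteq> J})"
    using finS finite_ksubsets by (intro card_mono) auto
  also have "\<dots> \<le> (\<Sum>V\<in>?S. card {J \<in> ksubsets n k. V \<subseteq> J})"
    using finS by (rule card_UN_le)
  also have "\<dots> = (\<Sum>V\<in>?S. (n - h) choose (k - h))"
    using assms I by (intro sum.cong card_ksubsets_superset) auto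
  also have "\<dots> = (k choose h) * ((n - h) choose (k - h))"
    using n_subsets[OF finI, of h] I by simp
  finally have "real (card {J \<in> ksubsets n k. card (I \<inter> J) = h})
    \<le> real (k choose h) * real ((n - h) choose (k - h))"
    by (metis of_nat_le_iff of_nat_mult)
  also have "real ((n - h) choose (k - h)) \<le> real (n choose k) * (real k / real n) ^ h"
    using divide_binomial_le[OF assms(2,3)] False by (simp add: power_divide field_simps)
  finally show ?thesis by (simp add: card_ksubsets mult.left_commute mult_left_mono)
qed

lemma sum_ksubsets_overlap:
  fixes f :: "nat \<Rightarrow> real"
  assumes "I \<in> ksubsets n k" "k \<le> n" and f: "\<And>h. f h \<ge> 0"
  shows "(\<Sum>J\<in>ksubsets n k. f (card (I \<inter> J)))
    \<le> card (ksubsets n k) * (\<Sum>h\<le>k. f h * (real (k choose h) * (real k / real n) ^ h))"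
proof -
  have I: "I \<subseteq> {..<n}" and cI: "card I = k" using assms(1) by (simp_all add: ksubsets_def)
  have finI: "finite I" by (rule finite_subset[OF I]) simp
  have "(\<Sum>J\<in>ksubsets n k. f (card (I \<inter> J)))
    = (\<Sum>h\<le>k. \<Sum>J\<in>{J \<in> ksubsets n k. card (I \<inter> J) = h}. f (card (I \<inter> J)))"
    using finI cI by (intro sum.group[symmetric] finite_ksubsets) (auto intro: card_mono)
  also have "\<dots> = (\<Sum>h\<le>k. f h * real (card {J \<in> ksubsets n k. card (I \<inter> J) = h}))"
    by (intro sum.cong refl) (simp add: mult.commute)
  also have "\<dots> \<le> (\<Sum>h\<le>k. f h * (real (card (ksubsets n k)) * (real (k choose h) * (real k / real n) ^ h)))"
    using assms by (intro sum_mono mult_left_mono card_ksubsets_overlap) auto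
  also have "\<dots> = card (ksubsets n k) * (\<Sum>h\<le>k. f h * (real (k choose h) * (real k / real n) ^ h))"
    by (simp add: sum_distrib_left mult.left_commute)
  finally show ?thesis .
qed

text \<open>An upper bound for the mean of \<open>f\<close> at a hypergeometric overlap: the weights
  dominate the probabilities, but their total \<open>(1 + k / n) ^ k\<close> may exceed 1.\<close>

definition overlap_sum :: "nat \<Rightarrow> nat \<Rightarrow> (nat \<Rightarrow> real) \<Rightarrow> real" where
  "overlap_sum n k f = (\<Sum>h\<le>k. f h * (real (k choose h) * (real k / real n) ^ h))"

text \<open>Under the uniform prior the coordinates of \<open>J\<close> are independent, so the mean
  of a product factorizes.\<close>

lemma sum_PiE_prod:
  fixes q :: "nat \<Rightarrow> nat \<Rightarrow> real"
  assumes "\<And>i. i < d \<Longrightarrow> I i \<in> ksubsets (n i) (k i)" "\<And>i. i < d \<Longrightarrow> k i \<le> n i"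
    and "\<And>i h. q i h \<ge> 0"
  defines "F \<equiv> PiE {..<d} (\<lambda>i. ksubsets (n i) (k i))"
  shows "(\<Sum>J\<in>F. \<Prod>i<d. q i (card (I i \<inter> J i)))
    \<le> card F * (\<Prod>i<d. overlap_sum (n i) (k i) (q i))"
proof -
  have "(\<Sum>J\<in>F. \<Prod>i<d. q i (card (I i \<inter> J i)))
    = (\<Prod>i<d. \<Sum>J\<in>ksubsets (n i) (k i). q i (card (I i \<inter> J)))"
    unfolding F_def by (intro prod_sum_PiE[symmetric]) (auto simp: finite_ksubsets)
  also have "\<dots> \<le> (\<Prod>i<d. card (ksubsets (n i) (k i)) * overlap_sum (n i) (k i) (q i))"
    unfolding overlap_sum_def using assms by (intro prod_mono conjI sum_nonneg sum_ksubsets_overlap) auto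
  also have "\<dots> = card F * (\<Prod>i<d. overlap_sum (n i) (k i) (q i))"
    unfolding F_def by (simp add: prod.distrib card_PiE)
  finally show ?thesis .
qed

text \<open>Coordinates other than \<open>j\<close> are averaged exactly and contribute the factor
  1. Applying \<open>sum_PiE_prod\<close> with constant functions there would cost
  \<open>(1 + k i / n i) ^ k i\<close> for each of them.\<close>

lemma sum_PiE_coordinate:
  fixes f :: "nat \<Rightarrow> real" and d :: nat
  assumes "\<And>i. i < d \<Longrightarrow> I i \<in> ksubsets (n i) (k i)" "\<And>i. i < d \<Longrightarrow> k i \<le> n i"
    and f: "\<And>h. f h \<ge> 0" and j: "j < d"
  defines "F \<equiv> PiE {..<d} (\<lambda>i. ksubsets (n i) (k i))"
  shows "(\<Sum>J\<in>F. f (card (I j \<inter> J j))) \<le> card F * overlap_sum (n j) (k j) f"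
proof -
  have "(\<Sum>J\<in>F. f (card (I j \<inter> J j))) = (\<Sum>J\<in>F. \<Prod>i<d. if i = j then f (card (I i \<inter> J i)) else 1)"
  proof (rule sum.cong[OF refl])
    fix J :: "nat \<Rightarrow> nat set"
    show "f (card (I j \<inter> J j)) = (\<Prod>i<d. if i = j then f (card (I i \<inter> J i)) else 1)"
      using j prod.delta[of "{..<d}" j "\<lambda>i. f (card (I i \<inter> J i))"] by simp
  qed
  also have "\<dots> = (\<Prod>i<d. \<Sum>J\<in>ksubsets (n i) (k i). if i = j then f (card (I i \<inter> J)) else 1)"
    unfolding F_def by (intro prod_sum_PiE[symmetric]) (auto simp: finite_ksubsets)
  also have "\<dots> \<le> (\<Prod>i<d. card (ksubsets (n i) (k i)) * (if i = j then overlap_sum (n i) (k i) f else 1))"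
    unfolding overlap_sum_def using assms by (intro prod_mono conjI sum_nonneg) (auto intro: sum_ksubsets_overlap)
  also have "\<dots> = card F * overlap_sum (n j) (k j) f"
    unfolding F_def using j by (simp add: prod.distrib card_PiE prod.delta)
  finally show ?thesis .
qed

section \<open>Truncated second moment bound for the minimax risk\<close>

lemma integrable_mult_indicator_Collect:
  fixes f :: "'a \<Rightarrow> real"
  assumes "integrable M f" "{y \<in> space M. R y} \<in> sets M"
  shows "integrable M (\<lambda>y. f y * indicator {y. R y} y)"
proof -
  have "integrable M (\<lambda>y. f y * indicator {y \<in> space M. R y} y)"
    using assms by (intro integrable_real_mult_indicator)
  then show ?thesis
    by (rule Bochner_Integration.integrable_cong[OF refl, THEN iffD1, rotated]) (simp add: indicator_def)
qed

text \<open>The families \<open>J\<close> include the coordinatewise intersection of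
  \<open>I\<close> with any other planted family, and at this intersection the truncation is
  applied.\<close>

definition typical :: "nat \<Rightarrow> (nat \<Rightarrow> nat) \<Rightarrow> (nat \<Rightarrow> nat set) \<Rightarrow> real \<Rightarrow> real \<Rightarrow> (nat list \<Rightarrow> real) set" where
  "typical d n I lam E = {y \<in> space (obs_law d n (\<lambda>_. 0)). \<forall>J\<in>PiE {..<d} (\<lambda>i. Pow (I i)).
     sum y (block d J) \<le> lam * real (card (block d J)) + sqrt (2 * real (card (block d J)) * E)}"

section \<open>The uniform prior over planted blocks\<close>

locale planted = gaussian_tensor d n lam for d :: nat and n :: "nat \<Rightarrow> nat" and lam :: real +
  fixes k :: "nat \<Rightarrow> nat" and E :: real
  assumes k_le_n: "\<And>i. i < d \<Longrightarrow> k i \<le> n i" and lam_nonneg: "0 \<le> lam" and E_nonneg: "0 \<le> E"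
begin

abbreviation (input) "F \<equiv> PiE {..<d} (\<lambda>i. ksubsets (n i) (k i))"
abbreviation (input) "G I \<equiv> typical d n I lam E"

lemma finite_F: "finite F"
  by (intro finite_PiE) (auto simp: finite_ksubsets)

lemma F_nonempty: "F \<noteq> {}"
proof -
  have "ksubsets (n i) (k i) \<noteq> {}" if "i < d" for i
    using k_le_n[OF that] card_ksubsets[of "n i" "k i"] by (metis card.empty binomial_eq_0_iff not_le)
  then show ?thesis by (auto simp: PiE_eq_empty_iff)
qed

lemma F_D:
  assumes "I \<in> F" "i < d"
  shows "I i \<in> ksubsets (n i) (k i)" "I i \<subseteq> {..<n i}" "card (I i) = k i" "finite (I i)"
proof -
  show I: "I i \<in> ksubsets (n i) (k i)" using assms by (auto simp: PiE_iff)
  show "I i \<subseteq> {..<n i}" "card (I i) = k i" using I by (auto simp: ksubsets_def)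
  show "finite (I i)" by (rule finite_subset[of _ "{..<n i}"]) (use I in \<open>auto simp: ksubsets_def\<close>)
qed

lemma block_F: "I \<in> F \<Longrightarrow> block d I \<subseteq> tidx d n"
  by (intro block_subset_tidx F_D(2))

lemma subblock:
  assumes "J \<in> PiE {..<d} (\<lambda>i. Pow (I i))"
  shows "block d J \<subseteq> block d I"
  using assms by (intro block_mono) (auto simp: PiE_iff)

lemma finite_subblocks: "I \<in> F \<Longrightarrow> finite (PiE {..<d} (\<lambda>i. Pow (I i)))"
  using F_D(4) by (intro finite_PiE) auto

lemma card_subblocks: "I \<in> F \<Longrightarrow> card (PiE {..<d} (\<lambda>i. Pow (I i))) = 2 ^ (\<Sum>i<d. k i)"
  by (simp add: card_PiE card_Pow F_D power_sum)

lemma typical_sets: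
  assumes "I \<in> F"
  shows "G I \<in> sets P0"
  unfolding typical_def using subblock block_F[OF assms] finite_subblocks[OF assms]
  by (intro sets.sets_Collect_finite_All sets_sum_le) blast+

text \<open>Off the typical set some sub-block has too large a sum. A union bound over the
  \<open>2 ^ (\<Sum>i<d. k i)\<close> sub-blocks, each costing \<open>exp (- E)\<close> by
  \<open>LR_tail\<close>, bounds the lost mass.\<close>

lemma truncated_mass:
  assumes I: "I \<in> F"
  shows "1 - 2 ^ (\<Sum>i<d. k i) * exp (- E) \<le> (\<integral>y. LR (block d I) y * indicator (G I) y \<partial>P0)"
proof -
  let ?S = "block d I" and ?\<J> = "PiE {..<d} (\<lambda>i. Pow (I i))"
  let ?bad = "\<lambda>J y. lam * card (block d J) + sqrt (2 * card (block d J) * E) < sum y (block d J)"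
  have sub: "block d J \<subseteq> ?S" "block d J \<subseteq> tidx d n" if "J \<in> ?\<J>" for J
    using subblock[OF that] block_F[OF I] by auto
  have int1: "integrable P0 (\<lambda>y. LR ?S y * indicator (G I) y)"
    using I by (intro integrable_real_mult_indicator likelihood_integrable typical_sets)
  have int2: "integrable P0 (\<lambda>y. LR ?S y * indicator {y. ?bad J y} y)" if "J \<in> ?\<J>" for J
    using sub[OF that] by (intro integrable_mult_indicator_Collect likelihood_integrable sets_sum_less)
  have int3: "integrable P0 (\<lambda>y. \<Sum>J\<in>?\<J>. LR ?S y * indicator {y. ?bad J y} y)"
    by (intro Bochner_Integration.integrable_sum int2)
  have "1 = (\<integral>y. LR ?S y \<partial>P0)"
    by (simp add: likelihood_integral)
  also have "\<dots> \<le> (\<integral>y. LR ?S y * indicator (G I) y + (\<Sum>J\<in>?\<J>. LR ?S y * indicator {y. ?bad J y} y) \<partial>P0)"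
  proof (rule integral_mono)
    show "integrable P0 (LR ?S)" by (rule likelihood_integrable)
    show "integrable P0 (\<lambda>y. LR ?S y * indicator (G I) y + (\<Sum>J\<in>?\<J>. LR ?S y * indicator {y. ?bad J y} y))"
      by (intro Bochner_Integration.integrable_add int1 int3)
    fix y assume y: "y \<in> space P0"
    have nn: "0 \<le> (\<Sum>J\<in>?\<J>. LR ?S y * indicator {y. ?bad J y} y)"
      using LR_nonneg by (intro sum_nonneg mult_nonneg_nonneg) auto
    show "LR ?S y \<le> LR ?S y * indicator (G I) y + (\<Sum>J\<in>?\<J>. LR ?S y * indicator {y. ?bad J y} y)"
    proof (cases "y \<in> G I")
      case True
      then show ?thesis using nn by simp
    next
      case False
      then obtain J where J: "J \<in> ?\<J>" "?bad J y"
        using y by (auto simp: typical_def not_le)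
      have "LR ?S y = LR ?S y * indicator {y. ?bad J y} y" using J by simp
      also have "\<dots> \<le> (\<Sum>J\<in>?\<J>. LR ?S y * indicator {y. ?bad J y} y)"
        using J finite_subblocks[OF I] LR_nonneg by (intro member_le_sum) auto
      finally show ?thesis using LR_nonneg[of ?S y] False by simp
    qed
  qed
  also have "\<dots> = (\<integral>y. LR ?S y * indicator (G I) y \<partial>P0)
      + (\<Sum>J\<in>?\<J>. \<integral>y. LR ?S y * indicator {y. ?bad J y} y \<partial>P0)"
    using int1 int2 int3 by (subst Bochner_Integration.integral_add) (auto simp: Bochner_Integration.integral_sum)
  also have "(\<Sum>J\<in>?\<J>. \<integral>y. LR ?S y * indicator {y. ?bad J y} y \<partial>P0) \<le> (\<Sum>J\<in>?\<J>. exp (- E))"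
    using sub block_F[OF I] E_nonneg by (intro sum_mono LR_tail) auto
  also have "\<dots> = 2 ^ (\<Sum>i<d. k i) * exp (- E)"
    by (simp add: card_subblocks[OF I])
  finally show ?thesis by simp
qed

text \<open>The first entry is the plain second moment, good for small overlap, where the square
  root in the second would dominate. The second halves the leading exponent and is good for overlap
  comparable to the whole block.\<close>

definition overlap_bound :: "real \<Rightarrow> real" where
  "overlap_bound v = min (exp (lam\<^sup>2 * v)) (exp (lam\<^sup>2 * v / 2 + lam * sqrt (2 * v * E)))"

lemma truncated_product:
  assumes I: "I \<in> F" and J: "J \<in> F"
  defines "f \<equiv> (\<lambda>y. (LR (block d I) y * indicator (G I) y) * (LR (block d J) y * indicator (G J) y))"
  shows truncated_product_integrable: "integrable P0 f"
    and truncated_product_integral: "(\<integral>y. f y \<partial>P0) \<le> overlap_bound (\<Prod>i<d. real (card (I i \<inter> J i)))"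
proof -
  let ?S = "block d I" and ?S' = "block d J"
  have sub: "?S \<subseteq> tidx d n" "?S' \<subseteq> tidx d n" using I J by (auto dest: block_F)
  have f: "f = (\<lambda>y. (LR ?S y * LR ?S' y) * indicator (G I \<inter> G J) y)"
    by (auto simp: f_def indicator_def)
  have intLR: "integrable P0 (\<lambda>y. LR ?S y * LR ?S' y)"
    using sub by (rule LR_product_integrable)
  show int: "integrable P0 f"
    unfolding f by (intro integrable_real_mult_indicator intLR sets.Int typical_sets I J)
  let ?v = "card (?S \<inter> ?S')"
  have v: "real ?v = (\<Prod>i<d. real (card (I i \<inter> J i)))"
    by (simp add: block_Int card_block)
  have LR0: "0 \<le> LR ?S y * LR ?S' y" for y using LR_nonneg by simp
  have "(\<integral>y. f y \<partial>P0) \<le> (\<integral>y. LR ?S y * LR ?S' y \<partial>P0)"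
    using int intLR unfolding f by (rule integral_mono) (use LR0 in \<open>auto simp: indicator_def\<close>)
  also have "\<dots> = exp (lam\<^sup>2 * ?v)" using sub by (rule LR_product_integral)
  finally have 1: "(\<integral>y. f y \<partial>P0) \<le> exp (lam\<^sup>2 * ?v)" .
  let ?\<tau> = "sqrt (2 * ?v * E)"
  let ?C = "{y. sum y (?S \<inter> ?S') \<le> lam * ?v + ?\<tau>}"
  have C: "y \<in> ?C" if "y \<in> G I" for y
  proof -
    \<comment> \<open>\<open>restrict\<close> makes the family of intersections extensional, hence a
      member of the index set in \<open>typical\<close>; the block does not change.\<close>
    let ?K = "restrict (\<lambda>i. I i \<inter> J i) {..<d}"
    have K: "?K \<in> PiE {..<d} (\<lambda>i. Pow (I i))" by auto
    have "\<forall>J\<in>PiE {..<d} (\<lambda>i. Pow (I i)).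
        sum y (block d J) \<le> lam * card (block d J) + sqrt (2 * card (block d J) * E)"
      using that by (simp add: typical_def)
    from bspec[OF this K] show ?thesis by (simp add: block_restrict block_Int)
  qed
  have intC: "integrable P0 (\<lambda>y. LR ?S y * LR ?S' y * indicator ?C y)"
    using sub by (intro integrable_mult_indicator_Collect intLR sets_sum_le) auto
  have "(\<integral>y. f y \<partial>P0) \<le> (\<integral>y. LR ?S y * LR ?S' y * indicator ?C y \<partial>P0)"
    using int intC unfolding f
  proof (rule integral_mono)
    fix y
    show "LR ?S y * LR ?S' y * indicator (G I \<inter> G J) y \<le> LR ?S y * LR ?S' y * indicator ?C y"
      using LR0[of y] C[of y] by (intro mult_left_mono) (auto simp: indicator_def)
  qed
  also have "\<dots> \<le> exp (lam\<^sup>2 * ?v / 2 + lam * ?\<tau>)"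
    using sub lam_nonneg by (rule LR_product_truncated)
  finally show "(\<integral>y. f y \<partial>P0) \<le> overlap_bound (\<Prod>i<d. real (card (I i \<inter> J i)))"
    using 1 unfolding overlap_bound_def v[symmetric] by simp
qed

lemma chc_measure:
  assumes "I \<in> F" "A \<in> sets P0"
  shows "(\<integral>y. LR (block d I) y * indicator A y \<partial>P0) = measure (obs_law d n (chc_tensor d lam I)) A"
proof -
  have "likelihood (tidx d n) (chc_tensor d lam I) = LR (block d I)"
    unfolding likelihood_def by (intro ext arg_cong[of _ _ exp] sum.cong refl) (simp add: chc_tensor_eq)
  then show ?thesis using assms(2) by (simp add: obs_law_measure)
qed

lemma chc_class_F: "I \<in> F \<Longrightarrow> chc_tensor d lam I \<in> chc_class d n k lam"
  unfolding chc_class_def using F_D(2,3)[of I]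
  by (intro CollectI exI[of _ lam] exI[of _ I] conjI allI impI) simp_all

lemma measure_obs_law_le_1: "measure (obs_law d n X) A \<le> 1"
  by (rule prob_space.prob_le_1[OF prob_space_obs_law])

lemma risk_bdd_above: "bdd_above ((\<lambda>X. measure (obs_law d n X) (A X)) ` C)"
  by (rule bdd_aboveI2[where M = 1]) (rule measure_obs_law_le_1)

text \<open>The worst case over the class is at least the average over the prior, so the truncated
  second moment method applies to every test. The form of \<open>dom\<close> follows what averages
  well: a constant, terms in one coordinate (\<open>sum_PiE_coordinate\<close>) and a full product
  (\<open>sum_PiE_prod\<close>).\<close>

lemma minimax_risk_ge:
  assumes dom: "\<And>h. (\<And>i. i < d \<Longrightarrow> h i \<le> k i) \<Longrightarrow>
      overlap_bound (\<Prod>i<d. real (h i)) \<le> e + (\<Sum>j<d. g j (h j)) + (\<Prod>i<d. q i (h i))"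
    and g: "\<And>j h. 0 \<le> g j h" and q: "\<And>j h. 0 \<le> q j h"
    and Q: "e + (\<Sum>j<d. overlap_sum (n j) (k j) (g j)) + (\<Prod>i<d. overlap_sum (n i) (k i) (q i)) \<le> Q"
  shows "1 - sqrt (Q - 1 + 2 * (2 ^ (\<Sum>i<d. k i) * exp (- E))) \<le> minimax_risk d n k lam"
  unfolding minimax_risk_def
proof (rule cINF_greatest)
  have "(\<lambda>_. False) \<in> tests d n" by (simp add: tests_def)
  then show "tests d n \<noteq> {}" by auto
  fix \<phi> assume \<phi>: "\<phi> \<in> tests d n"
  interpret P: prob_space P0 by (rule prob_space_obs_law)
  define A where "A = {y \<in> space P0. \<phi> y}"
  have A: "A \<in> sets P0"
  proof -
    have "\<phi> \<in> measurable P0 (count_space UNIV)"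
      using \<phi> by (simp add: tests_def measurable_cong_sets[OF sets_obs_law refl])
    then show ?thesis unfolding A_def by (rule predE)
  qed
  define m where "m = (\<lambda>I. \<integral>y. LR (block d I) y * indicator (space P0 - A) y \<partial>P0)"
  define s where "s = (SUP X \<in> chc_class d n k lam. measure (obs_law d n X) {y \<in> space (obs_law d n X). \<not> \<phi> y})"
  have "1 - sqrt (Q - 1 + 2 * (2 ^ (\<Sum>i<d. k i) * exp (- E))) \<le> measure P0 A + (\<Sum>I\<in>F. m I) / card F"
    unfolding m_def
  proof (rule P.truncated_second_moment[where l = "\<lambda>I y. LR (block d I) y * indicator (G I) y"])
    show "finite F" "F \<noteq> {}" "A \<in> sets P0" using finite_F F_nonempty A by auto
    fix I assume I: "I \<in> F"
    show "integrable P0 (LR (block d I))" by (rule likelihood_integrable)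
    show "integrable P0 (\<lambda>y. LR (block d I) y * indicator (G I) y)"
      using I by (intro integrable_real_mult_indicator likelihood_integrable typical_sets)
    show "0 \<le> LR (block d I) y * indicator (G I) y \<and> LR (block d I) y * indicator (G I) y \<le> LR (block d I) y" for y
      using LR_nonneg[of "block d I" y] by (auto simp: indicator_def)
    show "integrable P0 (\<lambda>y. (LR (block d I) y * indicator (G I) y) * (LR (block d J) y * indicator (G J) y))"
      if "J \<in> F" for J using I that by (rule truncated_product_integrable)
    show "1 - 2 ^ (\<Sum>i<d. k i) * exp (- E) \<le> P.expectation (\<lambda>y. LR (block d I) y * indicator (G I) y)"
      using I by (rule truncated_mass)
    have ov: "overlap_bound (\<Prod>i<d. real (card (I i \<inter> J i)))
        \<le> e + (\<Sum>j<d. g j (card (I j \<inter> J j))) + (\<Prod>i<d. q i (card (I i \<inter> J i)))" for J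
    proof (rule dom)
      fix i assume "i < d"
      then show "card (I i \<inter> J i) \<le> k i"
        using F_D[OF I] by (metis card_mono inf_le1)
    qed
    have c0: "0 \<le> real (card F)" by simp
    have IF: "\<And>i. i < d \<Longrightarrow> I i \<in> ksubsets (n i) (k i)" using F_D(1)[OF I] .
    have "(\<Sum>J\<in>F. P.expectation (\<lambda>y. (LR (block d I) y * indicator (G I) y) * (LR (block d J) y * indicator (G J) y)))
      \<le> (\<Sum>J\<in>F. e + (\<Sum>j<d. g j (card (I j \<inter> J j))) + (\<Prod>i<d. q i (card (I i \<inter> J i))))"
      by (intro sum_mono order.trans[OF truncated_product_integral[OF I] ov])
    also have "\<dots> = card F * e + (\<Sum>j<d. \<Sum>J\<in>F. g j (card (I j \<inter> J j))) + (\<Sum>J\<in>F. \<Prod>i<d. q i (card (I i \<inter> J i)))"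
      by (simp add: sum.distrib sum.swap[of _ "{..<d}"])
    also have "\<dots> \<le> card F * e + (\<Sum>j<d. card F * overlap_sum (n j) (k j) (g j))
        + card F * (\<Prod>i<d. overlap_sum (n i) (k i) (q i))"
      using g q k_le_n IF
      by (intro add_mono order_refl sum_mono sum_PiE_coordinate sum_PiE_prod) auto
    also have "\<dots> = card F * (e + (\<Sum>j<d. overlap_sum (n j) (k j) (g j)) + (\<Prod>i<d. overlap_sum (n i) (k i) (q i)))"
      by (simp add: distrib_left sum_distrib_left)
    also have "\<dots> \<le> card F * Q" using Q c0 by (rule mult_left_mono)
    finally show "(\<Sum>J\<in>F. P.expectation (\<lambda>y. (LR (block d I) y * indicator (G I) y) * (LR (block d J) y * indicator (G J) y)))
      \<le> Q * card F" by (simp add: mult.commute)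
  qed
  \<comment> \<open>Each planted tensor belongs to the class, so the supremum dominates every
    summand and thus the average.\<close>
  also have "(\<Sum>I\<in>F. m I) / card F \<le> s"
  proof -
    have "m I \<le> s" if I: "I \<in> F" for I
    proof -
      have "m I = measure (obs_law d n (chc_tensor d lam I)) (space P0 - A)"
        unfolding m_def using A by (intro chc_measure I) auto
      also have "space P0 - A = {y \<in> space (obs_law d n (chc_tensor d lam I)). \<not> \<phi> y}"
        by (auto simp: A_def space_obs_law)
      also have "measure (obs_law d n (chc_tensor d lam I)) \<dots> \<le> s"
        unfolding s_def using chc_class_F[OF I] risk_bdd_above by (rule cSUP_upper)
      finally show ?thesis .
    qed
    then have "(\<Sum>I\<in>F. m I) \<le> card F * s"
      by (rule sum_bounded_above)
    then show ?thesis using finite_F F_nonempty by (simp add: divide_le_eq card_gt_0_iff mult.commute)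
  qed
  finally show "1 - sqrt (Q - 1 + 2 * (2 ^ (\<Sum>i<d. k i) * exp (- E))) \<le> test_risk d n k lam \<phi>"
    unfolding test_risk_def s_def[symmetric] A_def by simp
qed

text \<open>The test that never rejects has no error of the first kind and at most 1 of the second.
  Nonnegativity of all risks bounds the set from below, so that its infimum over the reals is
  meaningful.\<close>

lemma minimax_risk_le_1: "minimax_risk d n k lam \<le> 1"
proof -
  obtain I0 where I0: "I0 \<in> F" using F_nonempty by blast
  have ne: "chc_class d n k lam \<noteq> {}" using chc_class_F[OF I0] by blast
  have "0 \<le> test_risk d n k lam \<phi>" for \<phi>
  proof -
    have "0 \<le> measure (obs_law d n (chc_tensor d lam I0)) {y \<in> space (obs_law d n (chc_tensor d lam I0)). \<not> \<phi> y}"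
      by simp
    also have "\<dots> \<le> (SUP X \<in> chc_class d n k lam. measure (obs_law d n X) {y \<in> space (obs_law d n X). \<not> \<phi> y})"
      using chc_class_F[OF I0] risk_bdd_above by (rule cSUP_upper)
    finally show ?thesis by (simp add: test_risk_def)
  qed
  then have "bdd_below (test_risk d n k lam ` tests d n)" by (intro bdd_belowI2)
  moreover have "(\<lambda>_. False) \<in> tests d n" by (simp add: tests_def)
  ultimately have "minimax_risk d n k lam \<le> test_risk d n k lam (\<lambda>_. False)"
    unfolding minimax_risk_def by (rule cINF_lower)
  also have "\<dots> \<le> 1"
    unfolding test_risk_def using ne by (auto intro!: cSUP_least measure_obs_law_le_1)
  finally show ?thesis .
qed

end

section \<open>Non-asymptotic bounds\<close>

lemma power_self_le_fact_exp: "real h ^ h \<le> fact h * exp (real h)"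
proof -
  have s: "summable (\<lambda>m. inverse (fact m) * real h ^ m)" by (rule summable_exp)
  \<comment> \<open>A single term of the exponential series at \<open>h\<close>.\<close>
  have "inverse (fact h) * real h ^ h = (\<Sum>m\<in>{h}. inverse (fact m) * real h ^ m)" by simp
  also have "\<dots> \<le> (\<Sum>m. inverse (fact m) * real h ^ m)"
    using s by (intro sum_le_suminf) auto
  also have "\<dots> = exp (real h)" by (simp add: exp_def)
  finally have "fact h * (inverse (fact h) * real h ^ h) \<le> fact h * exp (real h)"
    by (rule mult_left_mono) simp
  then show ?thesis by (simp add: mult.assoc[symmetric])
qed

text \<open>This is \<open>k choose h \<le> (e * k / h) ^ h\<close>. The logarithm compares the mean
  overlap \<open>k\<^sup>2 / n\<close> with \<open>h\<close>, so the weight decays once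
  \<open>h\<close> is a large multiple of the mean.\<close>

lemma overlap_weight_le:
  assumes "1 \<le> h" "h \<le> k" "1 \<le> n"
  shows "real (k choose h) * (real k / real n) ^ h
    \<le> exp (real h * (1 + ln ((real k)\<^sup>2 / (real h * real n))))"
proof -
  have h: "real h > 0" and k: "real k > 0" and n: "real n > 0" using assms by auto
  have "real (k choose h) * fact h \<le> real k ^ h"
    using binomial_fact_pow[of k h] by (metis of_nat_fact of_nat_le_iff of_nat_mult of_nat_power)
  then have "real (k choose h) * (fact h * exp (real h)) \<le> real k ^ h * exp (real h)"
    unfolding mult.assoc[symmetric] by (rule mult_right_mono) simp
  moreover have "real (k choose h) * real h ^ h \<le> real (k choose h) * (fact h * exp (real h))"
    by (intro mult_left_mono power_self_le_fact_exp) simp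
  ultimately have "real (k choose h) * real h ^ h \<le> real k ^ h * exp (real h)" by linarith
  then have "real (k choose h) \<le> (real k / real h) ^ h * exp (real h)"
    using h by (simp add: power_divide field_simps)
  then have "real (k choose h) * (real k / real n) ^ h \<le> (real k / real h) ^ h * exp (real h) * (real k / real n) ^ h"
    by (rule mult_right_mono) simp
  also have "\<dots> = (exp 1 * ((real k)\<^sup>2 / (real h * real n))) ^ h"
    by (simp add: power_mult_distrib power_divide exp_of_nat_mult[symmetric] power2_eq_square)
  also have "\<dots> = exp (1 + ln ((real k)\<^sup>2 / (real h * real n))) ^ h"
    using h k n by (simp add: exp_add)
  also have "\<dots> = exp (real h * (1 + ln ((real k)\<^sup>2 / (real h * real n))))"
    by (simp add: exp_of_nat_mult)
  finally show ?thesis .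
qed

text \<open>Each term is at most \<open>exp (- 2 * h)\<close>: one factor \<open>exp (- h)\<close>
  is below \<open>exp (- M)\<close>, the other gives a geometric series.\<close>

lemma overlap_sum_tail:
  assumes "1 \<le> n" "0 \<le> M"
    and a: "\<And>h. h \<le> k \<Longrightarrow> M < real h \<Longrightarrow>
      a h + real h * (1 + ln ((real k)\<^sup>2 / (real h * real n))) \<le> - (2 * real h)"
  shows "overlap_sum n k (\<lambda>h. if M < real h then exp (a h) else 0) \<le> 2 * exp (- M)"
proof -
  have "overlap_sum n k (\<lambda>h. if M < real h then exp (a h) else 0) \<le> (\<Sum>h\<le>k. exp (- M) * (1 / 2) ^ h)"
    unfolding overlap_sum_def
  proof (rule sum_mono)
    fix h assume h: "h \<in> {..k}"
    show "(if M < real h then exp (a h) else 0) * (real (k choose h) * (real k / real n) ^ h) \<le> exp (- M) * (1 / 2) ^ h"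
    proof (cases "M < real h")
      case True
      then have h1: "1 \<le> h" using assms(2) by (cases h) auto
      have "exp (a h) * (real (k choose h) * (real k / real n) ^ h)
        \<le> exp (a h) * exp (real h * (1 + ln ((real k)\<^sup>2 / (real h * real n))))"
        using h h1 assms(1) by (intro mult_left_mono overlap_weight_le) auto
      also have "\<dots> = exp (a h + real h * (1 + ln ((real k)\<^sup>2 / (real h * real n))))"
        by (simp add: exp_add)
      also have "\<dots> \<le> exp (- M + real h * - 1)"
        using a[of h] h True by simp
      also have "\<dots> = exp (- M) * exp (- 1) ^ h"
        by (simp only: exp_add exp_of_nat_mult)
      also have "\<dots> \<le> exp (- M) * (1 / 2) ^ h"
      proof (intro mult_left_mono power_mono)
        show "exp (- 1) \<le> (1 / 2 :: real)"
          using exp_ge_add_one_self[of 1] by (simp add: exp_minus field_simps)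
      qed auto
      finally show ?thesis using True by simp
    qed simp
  qed
  also have "\<dots> = exp (- M) * (\<Sum>h\<le>k. (1 / 2) ^ h)" by (simp add: sum_distrib_left)
  also have "(\<Sum>h\<le>k. (1 / 2) ^ h) \<le> (2 :: real)"
    by (subst sum_gp0) (simp add: field_simps)
  finally show ?thesis by (simp add: mult.commute)
qed

lemma two_power_le_exp: "(2::real) ^ m \<le> exp (real m)"
proof -
  have "(2::real) ^ m \<le> exp 1 ^ m" using exp_ge_add_one_self[of 1] by (intro power_mono) auto
  then show ?thesis by (simp add: exp_of_nat_mult[symmetric])
qed

text \<open>The factor \<open>(k / n) ^ h\<close> is \<open>exp (- L * h)\<close>. For
  \<open>h \<ge> \<eta> * k\<close> the surplus \<open>(1 - \<gamma>) * L * h\<close> is at least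
  \<open>2 * k\<close>, while all binomial coefficients together cost only
  \<open>2 ^ k \<le> exp k\<close>.\<close>

lemma overlap_sum_large:
  assumes k: "1 \<le> k" "k \<le> n" and \<gamma>: "\<gamma> < 1" and \<eta>: "0 < \<eta>"
    and L: "2 / ((1 - \<gamma>) * \<eta>) \<le> ln (real n / real k)"
  shows "overlap_sum n k (\<lambda>h. if \<eta> * real k \<le> real h then exp (\<gamma> * ln (real n / real k) * real h) else 0)
    \<le> exp (- real k)"
proof -
  define L where "L = ln (real n / real k)"
  have kn: "real k / real n = exp (- L)"
    using k by (simp add: L_def ln_div exp_diff)
  have L2: "2 \<le> (1 - \<gamma>) * L * \<eta>"
    using assms unfolding L_def[symmetric] by (simp add: field_simps)
  have Lpos: "0 \<le> (1 - \<gamma>) * L"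
    using L2 \<eta> by (smt (verit) mult_nonpos_nonneg)
  have "overlap_sum n k (\<lambda>h. if \<eta> * real k \<le> real h then exp (\<gamma> * ln (real n / real k) * real h) else 0)
    \<le> (\<Sum>h\<le>k. exp (- (2 * real k)) * real (k choose h))"
    unfolding overlap_sum_def L_def[symmetric] kn
  proof (rule sum_mono)
    fix h
    show "(if \<eta> * real k \<le> real h then exp (\<gamma> * L * real h) else 0) * (real (k choose h) * exp (- L) ^ h)
      \<le> exp (- (2 * real k)) * real (k choose h)"
    proof (cases "\<eta> * real k \<le> real h")
      case True
      have "exp (\<gamma> * L * real h) * exp (- L) ^ h = exp (- ((1 - \<gamma>) * L * real h))"
        by (simp add: exp_of_nat_mult[symmetric] exp_add[symmetric] algebra_simps)
      also have "\<dots> \<le> exp (- (2 * real k))"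
      proof -
        have "2 * real k \<le> (1 - \<gamma>) * L * \<eta> * real k" using L2 by (intro mult_right_mono) auto
        also have "\<dots> = ((1 - \<gamma>) * L) * (\<eta> * real k)" by (simp only: mult.assoc)
        also have "\<dots> \<le> (1 - \<gamma>) * L * real h" using True Lpos by (rule mult_left_mono)
        finally show ?thesis by simp
      qed
      finally have "exp (\<gamma> * L * real h) * exp (- L) ^ h \<le> exp (- (2 * real k))" .
      then have "exp (\<gamma> * L * real h) * exp (- L) ^ h * real (k choose h) \<le> exp (- (2 * real k)) * real (k choose h)"
        by (rule mult_right_mono) simp
      then show ?thesis using True by (simp add: mult_ac)
    qed simp
  qed
  also have "\<dots> = exp (- (2 * real k)) * 2 ^ k"
    unfolding sum_distrib_left[symmetric] using choose_row_sum[of k]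
    by (metis of_nat_numeral of_nat_power of_nat_sum)
  also have "\<dots> \<le> exp (- (2 * real k)) * exp (real k)"
    by (intro mult_left_mono two_power_le_exp) simp
  also have "\<dots> = exp (- real k)" by (simp add: exp_add[symmetric])
  finally show ?thesis .
qed

section \<open>Risk bounds with explicit constants\<close>

lemma prod_le_factor:
  fixes f :: "'a \<Rightarrow> real"
  assumes "finite S" "i \<in> S" "\<And>x. x \<in> S \<Longrightarrow> 0 \<le> f x \<and> f x \<le> 1"
  shows "prod f S \<le> f i"
proof -
  have "prod f (S - {i}) \<le> 1" using assms by (intro prod_le_1) auto
  then have "f i * prod f (S - {i}) \<le> f i * 1" using assms by (intro mult_left_mono) auto
  then show ?thesis using assms by (simp add: prod.remove)
qed

text \<open>A constant multiple of the mean overlap \<open>k\<^sup>2 / n\<close>, floored at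
  \<open>\<omega>\<close> so that exceeding it has probability of order
  \<open>exp (- \<omega>)\<close> even when the mean is tiny. The 5 leaves room for the unit losses
  in the exponent while keeping it below \<open>- 2 * h\<close>, as \<open>overlap_sum_tail\<close>
  asks.\<close>

definition overlap_cutoff :: "real \<Rightarrow> nat \<Rightarrow> nat \<Rightarrow> real" where
  "overlap_cutoff \<omega> n k = max \<omega> (exp 5 * (real k)\<^sup>2 / real n)"

lemma ln_above_cutoff:
  assumes "overlap_cutoff \<omega> n k < real h" "0 \<le> \<omega>" "1 \<le> k" "1 \<le> n"
  shows "ln ((real k)\<^sup>2 / (real h * real n)) \<le> - 5"
proof -
  have h: "0 < real h" using assms by (simp add: overlap_cutoff_def)
  have "exp 5 * (real k)\<^sup>2 / real n < real h" using assms by (simp add: overlap_cutoff_def)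
  then have "(real k)\<^sup>2 / (real h * real n) \<le> exp (- 5)"
    using h assms by (simp add: exp_minus field_simps)
  then have "ln ((real k)\<^sup>2 / (real h * real n)) \<le> ln (exp (- 5))"
    using h assms by (subst ln_le_cancel_iff) auto
  then show ?thesis by simp
qed

text \<open>If every overlap is below its cutoff, \<open>\<delta>\<close> bounds the exponent.
  Otherwise some \<open>h j\<close> exceeds it, and bounding the other overlaps by \<open>K\<close>
  gives exponent at most \<open>h j * lam\<^sup>2 * K ^ (d - 1) \<le> h j\<close>, which the tail of
  the \<open>j\<close>-th overlap absorbs.\<close>

lemma balanced_risk_bound:
  assumes d: "1 \<le> d" and nk: "\<And>i. i < d \<Longrightarrow> n i = N \<and> k i = K" and K: "1 \<le> K" "K \<le> N"
    and lam: "0 \<le> lam" and \<omega>: "0 \<le> \<omega>"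
    and s: "lam\<^sup>2 * real K ^ (d - 1) \<le> 1" and \<delta>: "lam\<^sup>2 * overlap_cutoff \<omega> N K ^ d \<le> \<delta>"
  shows "1 - sqrt (exp \<delta> - 1 + (2 * real d + 2) * exp (- \<omega>)) \<le> minimax_risk d n k lam"
proof -
  \<comment> \<open>This makes the mass lost to truncation at most
    \<open>exp (- \<omega>)\<close>.\<close>
  define E where "E = real (\<Sum>i<d. k i) + \<omega>"
  interpret planted d n lam k E
    by unfold_locales (use nk K lam \<omega> in \<open>auto simp: E_def intro: add_nonneg_nonneg\<close>)
  define M where "M = overlap_cutoff \<omega> N K"
  have M0: "0 \<le> M" "\<omega> \<le> M" using \<omega> by (auto simp: M_def overlap_cutoff_def)
  define g where "g = (\<lambda>(j::nat) h. if M < real h then exp (real h) else 0)"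
  have dom: "overlap_bound (\<Prod>i<d. real (h i)) \<le> exp \<delta> + (\<Sum>j<d. g j (h j)) + (\<Prod>i<d. 0)"
    if h: "\<And>i. i < d \<Longrightarrow> h i \<le> k i" for h
  proof -
    have hK: "h i \<le> K" if "i < d" for i using h[OF that] nk[OF that] by simp
    have g0: "0 \<le> (\<Sum>j<d. g j (h j))" by (intro sum_nonneg) (auto simp: g_def)
    have le: "overlap_bound (\<Prod>i<d. real (h i)) \<le> exp (lam\<^sup>2 * (\<Prod>i<d. real (h i)))"
      by (simp add: overlap_bound_def)
    have p0: "0 \<le> (\<Prod>i<d. 0::real)" by (intro prod_nonneg) auto
    show ?thesis
    proof (cases "\<forall>i<d. real (h i) \<le> M")
      case True
      then have "(\<Prod>i<d. real (h i)) \<le> (\<Prod>i<d. M)" by (intro prod_mono) auto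
      then have "lam\<^sup>2 * (\<Prod>i<d. real (h i)) \<le> lam\<^sup>2 * M ^ d" by (intro mult_left_mono) auto
      then have "lam\<^sup>2 * (\<Prod>i<d. real (h i)) \<le> \<delta>" using \<delta> by (simp add: M_def)
      then have "overlap_bound (\<Prod>i<d. real (h i)) \<le> exp \<delta>" by (intro order.trans[OF le]) simp
      then show ?thesis using g0 p0 by linarith
    next
      case False
      then obtain j where j: "j < d" "M < real (h j)" by (auto simp: not_le)
      have "(\<Prod>i\<in>{..<d} - {j}. real (h i)) \<le> (\<Prod>i\<in>{..<d} - {j}. real K)"
        using hK by (intro prod_mono) auto
      also have "\<dots> = real K ^ (d - 1)" using j by simp
      finally have "(\<Prod>i<d. real (h i)) \<le> real (h j) * real K ^ (d - 1)"
        using j by (simp add: prod.remove mult_left_mono)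
      then have "lam\<^sup>2 * (\<Prod>i<d. real (h i)) \<le> lam\<^sup>2 * (real (h j) * real K ^ (d - 1))"
        by (intro mult_left_mono) auto
      also have "\<dots> = real (h j) * (lam\<^sup>2 * real K ^ (d - 1))" by simp
      also have "\<dots> \<le> real (h j) * 1" using s by (intro mult_left_mono) auto
      finally have "lam\<^sup>2 * (\<Prod>i<d. real (h i)) \<le> real (h j)" by simp
      then have "overlap_bound (\<Prod>i<d. real (h i)) \<le> exp (real (h j))"
        using le by (intro order.trans[OF le]) simp
      also have "\<dots> = g j (h j)" using j by (simp add: g_def)
      also have "\<dots> \<le> (\<Sum>j<d. g j (h j))"
        using j by (intro member_le_sum) (auto simp: g_def)
      finally show ?thesis using p0 exp_ge_zero[of \<delta>] by linarith
    qed
  qed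
  have ov: "overlap_sum (n j) (k j) (g j) \<le> 2 * exp (- \<omega>)" if "j < d" for j
  proof -
    have "overlap_sum (n j) (k j) (g j) \<le> 2 * exp (- M)"
      unfolding g_def using nk[OF that] K M0
    proof (intro overlap_sum_tail)
      fix h assume "h \<le> k j" "M < real h"
      then have "ln ((real K)\<^sup>2 / (real h * real N)) \<le> - 5"
        unfolding M_def using K \<omega> by (intro ln_above_cutoff) auto
      then have "real h * (1 + ln ((real K)\<^sup>2 / (real h * real N))) \<le> real h * (- 4)"
        by (intro mult_left_mono) auto
      then show "real h + real h * (1 + ln ((real (k j))\<^sup>2 / (real h * real (n j)))) \<le> - (2 * real h)"
        using nk[OF that] by simp
    qed auto
    also have "\<dots> \<le> 2 * exp (- \<omega>)" using M0 by simp
    finally show ?thesis .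
  qed
  have "(\<Sum>j<d. overlap_sum (n j) (k j) (g j)) \<le> (\<Sum>j<d. 2 * exp (- \<omega>))"
    using ov by (intro sum_mono) auto
  \<comment> \<open>The product term vanishes because \<open>d \<ge> 1\<close>; an empty product
    would be 1.\<close>
  moreover have "(\<Prod>i<d. overlap_sum (n i) (k i) (\<lambda>_. 0)) = 0"
    using d by (auto simp: overlap_sum_def)
  ultimately have Q: "exp \<delta> + (\<Sum>j<d. overlap_sum (n j) (k j) (g j)) + (\<Prod>i<d. overlap_sum (n i) (k i) (\<lambda>_. 0))
    \<le> exp \<delta> + 2 * real d * exp (- \<omega>)" by (simp only: sum_constant card_lessThan)
  have main: "1 - sqrt (exp \<delta> + 2 * real d * exp (- \<omega>) - 1 + 2 * (2 ^ (\<Sum>i<d. k i) * exp (- E))) \<le> minimax_risk d n k lam"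
    by (rule minimax_risk_ge[OF dom _ _ Q]) (auto simp: g_def)
  have "2 ^ (\<Sum>i<d. k i) * exp (- E) \<le> exp (real (\<Sum>i<d. k i)) * exp (- E)"
    by (intro mult_right_mono two_power_le_exp) auto
  also have "\<dots> = exp (- \<omega>)" by (simp add: E_def exp_add[symmetric])
  finally have "sqrt (exp \<delta> + 2 * real d * exp (- \<omega>) - 1 + 2 * (2 ^ (\<Sum>i<d. k i) * exp (- E)))
    \<le> sqrt (exp \<delta> - 1 + (2 * real d + 2) * exp (- \<omega>))"
    by (intro real_sqrt_le_mono) (simp add: algebra_simps)
  then show ?thesis using main by linarith
qed

text \<open>With \<open>x = h / k\<close> the exponent per unit of \<open>h\<close> is \<open>2 C L min \<eta> x + 2 - ln x - L\<close>. For \<open>x \<le> exp (- L / 2)\<close> the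
first term is negligible and the cutoff controls the rest; for larger \<open>x\<close> both \<open>2 C L \<eta>\<close> and \<open>- ln x\<close>
are fractions of \<open>L\<close>.\<close>
lemma planted_exponent_le:
  fixes C L \<eta> \<omega> :: real
  assumes h: "h \<le> k" "overlap_cutoff \<omega> n k < real h" and \<omega>: "0 \<le> \<omega>" and k: "1 \<le> k" "k \<le> n"
    and L: "L = ln (real n / real k)" "16 \<le> L" and C: "0 \<le> C" "2 * C * \<eta> \<le> 1 / 4"
    and small: "2 * C * L * exp (- (L / 2)) \<le> 1"
  shows "real h * (2 * C * L * min \<eta> (real h / real k) + 1)
      + real h * (1 + ln ((real k)\<^sup>2 / (real h * real n))) \<le> - (2 * real h)"
proof -
  have h0: "0 < real h" using h \<omega> by (simp add: overlap_cutoff_def)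
  have k0: "0 < real k" "0 < real n" using k by auto
  define x where "x = real h / real k"
  have x0: "0 < x" using h0 k0 by (simp add: x_def)
  have "(real k)\<^sup>2 / (real h * real n) = inverse x * inverse (real n / real k)"
    using k0 h0 by (simp add: x_def field_simps power2_eq_square)
  also have "ln \<dots> = - ln x - L"
    using x0 k0 unfolding L(1) by (subst ln_mult) (simp_all add: ln_inverse del: inverse_divide)
  finally have ln_eq: "ln ((real k)\<^sup>2 / (real h * real n)) = - ln x - L" .
  have "2 * C * L * min \<eta> x + ln ((real k)\<^sup>2 / (real h * real n)) \<le> - 4"
  proof (cases "x \<le> exp (- (L / 2))")
    case True
    have "2 * C * L * min \<eta> x \<le> 2 * C * L * exp (- (L / 2))"
      using True C L by (intro mult_left_mono) auto
    also have "\<dots> \<le> 1" by (rule small)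
    finally show ?thesis using ln_above_cutoff[OF h(2) \<omega>] k by linarith
  next
    case False
    then have "ln (exp (- (L / 2))) < ln x" using x0 by (subst ln_less_cancel_iff) auto
    then have 1: "- ln x < L / 2" by simp
    have "2 * C * L * min \<eta> x \<le> 2 * C * L * \<eta>" using C L by (intro mult_left_mono) auto
    also have "\<dots> = L * (2 * C * \<eta>)" by simp
    also have "\<dots> \<le> L * (1 / 4)" using C L by (intro mult_left_mono) auto
    finally show ?thesis using 1 L(2) unfolding ln_eq by linarith
  qed
  then have "real h * (2 * C * L * min \<eta> x + ln ((real k)\<^sup>2 / (real h * real n))) \<le> real h * - 4"
    using h0 by (intro mult_left_mono) auto
  then show ?thesis unfolding x_def by (simp add: algebra_simps)
qed

text \<open>With \<open>\<rho> i = h i / k i\<close>, \<open>lamA\<close> turns the exponent into at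
  most \<open>2 * c * A * \<Prod> \<rho>\<close>, and \<open>AC\<close> compares \<open>A\<close>
  with a single coordinate. The hypotheses serve the cases in turn: \<open>mean_case\<close> and
  \<open>cut\<close> when all overlaps are below their cutoffs, \<open>L\<eta>\<close> and
  \<open>L\<kappa>\<close> when all \<open>\<rho> i \<ge> \<eta>\<close>, and \<open>cut\<close>,
  \<open>L16\<close>, \<open>Lexp\<close> otherwise. The value of \<open>\<eta>\<close> gives
  \<open>2 * C * \<eta> \<le> 1 / 4\<close>, which \<open>planted_exponent_le\<close> asks
  for.\<close>

lemma planted_risk_bound:
  fixes d :: nat and n k :: "nat \<Rightarrow> nat" and C c \<omega> \<delta> lam :: real
  defines "L \<equiv> \<lambda>i. ln (real (n i) / real (k i))"
  defines "A \<equiv> \<Sum>i<d. real (k i) * L i"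
  defines "\<eta> \<equiv> 1 / (8 * C)"
  assumes d: "2 \<le> d" and k: "\<And>i. i < d \<Longrightarrow> 1 \<le> k i \<and> k i \<le> n i"
    and lam: "0 \<le> lam" and \<omega>: "1 \<le> \<omega>" and \<delta>: "\<delta> \<le> 1" and C: "1 \<le> C" and c: "0 < c" "c < 1"
    and AC: "\<And>j. j < d \<Longrightarrow> A \<le> C * (real (k j) * L j)"
    and lamA: "lam\<^sup>2 * (\<Prod>i<d. real (k i)) \<le> 2 * c * A"
    and cut: "\<And>i j. i < d \<Longrightarrow> j < d \<Longrightarrow> i \<noteq> j \<Longrightarrow>
      \<omega> * (2 * C * L j * (overlap_cutoff \<omega> (n i) (k i) / real (k i))) \<le> \<delta>"
    and mean_case: "lam\<^sup>2 * (\<Prod>i<d. exp 5 * (real (k i))\<^sup>2 / real (n i)) \<le> \<delta>"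
    and L16: "\<And>i. i < d \<Longrightarrow> 16 \<le> L i"
    and Lexp: "\<And>i. i < d \<Longrightarrow> 2 * C * L i * exp (- (L i / 2)) \<le> 1"
    and L\<eta>: "\<And>i. i < d \<Longrightarrow> 2 / ((1 - (1 + c) / 2) * \<eta>) \<le> L i"
    and L\<kappa>: "\<And>i. i < d \<Longrightarrow> 8 / ((1 - c) * \<eta> / 2)\<^sup>2 \<le> L i"
  shows "1 - sqrt (exp \<delta> - 1 + 2 * real d * exp (- \<omega>) + 3 * exp (- real (\<Sum>i<d. k i))) \<le> minimax_risk d n k lam"
proof -
  \<comment> \<open>One half of \<open>E\<close> pays for the \<open>2 ^ (\<Sum>i<d. k i)\<close>
    sub-blocks; the other leaves a loss of \<open>exp (- (\<Sum>i<d. k i))\<close>.\<close>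
  define E where "E = 2 * real (\<Sum>i<d. k i)"
  \<comment> \<open>The midpoint of \<open>c\<close> and 1: the gap above \<open>c\<close> absorbs
    the square root from the truncation, the gap below 1 gives decay in
    \<open>overlap_sum_large\<close>.\<close>
  define \<gamma> where "\<gamma> = (1 + c) / 2"
  define M where "M = (\<lambda>i. overlap_cutoff \<omega> (n i) (k i))"
  have \<omega>M: "\<omega> \<le> M i" for i by (simp add: M_def overlap_cutoff_def)
  interpret planted d n lam k E
    by unfold_locales (use k lam in \<open>auto simp: E_def intro: sum_nonneg\<close>)
  have \<eta>: "0 < \<eta>" "2 * C * \<eta> \<le> 1 / 4" using C by (auto simp: \<eta>_def)
  have kpos: "0 < real (k i)" if "i < d" for i using k[OF that] by simp
  have L0: "0 \<le> L i" if "i < d" for i using L16[OF that] by simp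
  have kL0: "0 \<le> real (k i) * L i" if "i < d" for i using L0[OF that] by simp
  have A0: "0 \<le> A" unfolding A_def using kL0 by (intro sum_nonneg) auto
  \<comment> \<open>\<open>g\<close> pays for one atypically large overlap, \<open>q\<close> for all
    ratios being at least \<open>\<eta>\<close>. In \<open>g\<close>, \<open>min \<eta>\<close>
    reflects a second coordinate whose ratio is below both \<open>\<eta>\<close> and that of
    \<open>j\<close>; the \<open>+ 1\<close> covers the case where the largest ratio stays below its
    cutoff.\<close>
  define g where "g = (\<lambda>j h. if M j < real h then
    exp (real h * (2 * C * L j * min \<eta> (real h / real (k j)) + 1)) else 0)"
  define q where "q = (\<lambda>i h. if \<eta> * real (k i) \<le> real h then exp (\<gamma> * L i * real h) else 0)"
  have dom: "overlap_bound (\<Prod>i<d. real (h i)) \<le> exp \<delta> + (\<Sum>j<d. g j (h j)) + (\<Prod>i<d. q i (h i))"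
    if h: "\<And>i. i < d \<Longrightarrow> h i \<le> k i" for h
  proof -
    define \<rho> where "\<rho> = (\<lambda>i. real (h i) / real (k i))"
    have \<rho>: "0 \<le> \<rho> i \<and> \<rho> i \<le> 1" if "i < d" for i
      using h[OF that] kpos[OF that] by (simp add: \<rho>_def)
    have h\<rho>: "real (h i) = real (k i) * \<rho> i" if "i < d" for i
      using kpos[OF that] by (simp add: \<rho>_def)
    have g0: "0 \<le> (\<Sum>j<d. g j (h j))" by (intro sum_nonneg) (auto simp: g_def)
    have q0: "0 \<le> (\<Prod>i<d. q i (h i))" by (intro prod_nonneg) (auto simp: q_def)
    have hprod: "(\<Prod>i<d. real (h i)) = (\<Prod>i<d. real (k i)) * (\<Prod>i<d. \<rho> i)"
      using h\<rho> by (simp add: prod.distrib[symmetric])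
    have \<rho>prod0: "0 \<le> (\<Prod>i<d. \<rho> i)" using \<rho> by (intro prod_nonneg) auto
    have e1: "lam\<^sup>2 * (\<Prod>i<d. real (h i)) \<le> 2 * c * A * (\<Prod>i<d. \<rho> i)"
      using mult_right_mono[OF lamA \<rho>prod0] by (simp add: hprod mult.assoc)
    \<comment> \<open>Two factors of \<open>\<Prod> \<rho>\<close> are kept:
      \<open>\<rho> j\<close>, which turns \<open>k j\<close> into \<open>h j\<close>, and
      \<open>\<rho> i\<close>; the others are at most 1.\<close>
    have two: "lam\<^sup>2 * (\<Prod>i<d. real (h i)) \<le> real (h j) * (2 * C * L j * \<rho> i)"
      if ij: "i < d" "j < d" "i \<noteq> j" for i j
    proof -
      have "2 * c * A * (\<Prod>i<d. \<rho> i) \<le> 2 * A * (\<Prod>i<d. \<rho> i)"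
        using c A0 \<rho>prod0 by (intro mult_right_mono) (auto simp: mult_left_le_one_le)
      also have "\<dots> \<le> 2 * (C * (real (k j) * L j)) * (\<Prod>i<d. \<rho> i)"
        using AC[OF ij(2)] \<rho>prod0 by (intro mult_right_mono) auto
      also have "\<dots> = 2 * (C * (real (k j) * L j)) * (\<rho> j * (\<Prod>i\<in>{..<d} - {j}. \<rho> i))"
        using ij by (intro arg_cong[of _ _ "(*) _"] prod.remove) auto
      also have "\<dots> = (real (h j) * (2 * C * L j)) * (\<Prod>i\<in>{..<d} - {j}. \<rho> i)"
        using h\<rho>[OF ij(2)] by (simp add: mult_ac)
      also have "\<dots> \<le> (real (h j) * (2 * C * L j)) * \<rho> i"
        using ij \<rho> C L0[OF ij(2)] by (intro mult_left_mono prod_le_factor mult_nonneg_nonneg) auto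
      finally show ?thesis using e1 by (simp add: mult.assoc)
    qed
    have le1: "overlap_bound (\<Prod>i<d. real (h i)) \<le> exp (lam\<^sup>2 * (\<Prod>i<d. real (h i)))"
      and le2: "overlap_bound (\<Prod>i<d. real (h i)) \<le> exp (lam\<^sup>2 * (\<Prod>i<d. real (h i)) / 2 + lam * sqrt (2 * (\<Prod>i<d. real (h i)) * E))"
      by (simp_all add: overlap_bound_def)
    have \<rho>M: "\<rho> i \<le> M i / real (k i)" if "i < d" "real (h i) \<le> M i" for i
      unfolding \<rho>_def using that kpos by (intro divide_right_mono) auto
    show ?thesis
    proof (cases "\<forall>i<d. real (h i) \<le> M i")
      case True
      have "lam\<^sup>2 * (\<Prod>i<d. real (h i)) \<le> \<delta>"
      \<comment> \<open>Either every cutoff is the multiple of the mean, and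
        \<open>mean_case\<close> applies, or some \<open>M j\<close> is the floor
        \<open>\<omega>\<close>, and \<open>cut\<close> applies to \<open>j\<close> and any other
        coordinate.\<close>
      proof (cases "\<forall>i<d. M i = exp 5 * (real (k i))\<^sup>2 / real (n i)")
        case all: True
        have "(\<Prod>i<d. real (h i)) \<le> (\<Prod>i<d. exp 5 * (real (k i))\<^sup>2 / real (n i))"
          using True all by (intro prod_mono) auto
        then have "lam\<^sup>2 * (\<Prod>i<d. real (h i)) \<le> lam\<^sup>2 * (\<Prod>i<d. exp 5 * (real (k i))\<^sup>2 / real (n i))"
          by (intro mult_left_mono) auto
        then show ?thesis using mean_case by linarith
      next
        case False
        then obtain j where j: "j < d" "M j = \<omega>"
          by (auto simp: M_def overlap_cutoff_def max_def split: if_splits)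
        obtain i where i: "i < d" "i \<noteq> j"
          using d by (metis One_nat_def Suc_1 Suc_le_lessD less_2_cases_iff less_le_trans not_less_eq zero_neq_one)
        have "lam\<^sup>2 * (\<Prod>i<d. real (h i)) \<le> real (h j) * (2 * C * L j * \<rho> i)"
          using i j by (intro two) auto
        also have "\<dots> \<le> \<omega> * (2 * C * L j * (M i / real (k i)))"
          using True i j C L0[OF j(1)] \<rho>M \<rho> \<omega> by (intro mult_mono mult_left_mono mult_nonneg_nonneg) auto
        also have "\<dots> \<le> \<delta>" unfolding M_def using i j by (intro cut) auto
        finally show ?thesis .
      qed
      then have "overlap_bound (\<Prod>i<d. real (h i)) \<le> exp \<delta>"
        by (intro order.trans[OF le1]) simp
      then show ?thesis using g0 q0 by linarith
    next
      case False
      show ?thesis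
      proof (cases "\<forall>i<d. \<eta> \<le> \<rho> i")
        case True
        \<comment> \<open>Since \<open>E\<close> is negligible against \<open>A\<close>, the truncated bound is \<open>exp (\<lambda>\<^sup>2 v / 2)\<close> up to lower order,
          and \<open>\<Prod> \<rho> \<le> \<rho> i\<close> splits the exponent over the coordinates.\<close>
        define \<kappa> where "\<kappa> = (1 - c) * \<eta> / 2"
        have \<kappa>: "0 < \<kappa>" using c \<eta> by (simp add: \<kappa>_def)
        have "lam\<^sup>2 * (\<Prod>i<d. real (h i)) / 2 \<le> c * (A * (\<Prod>i<d. \<rho> i))"
          using e1 by simp
        also have "A * (\<Prod>i<d. \<rho> i) \<le> (\<Sum>i<d. L i * real (h i))"
          unfolding A_def sum_distrib_right
        proof (rule sum_mono)
          fix i assume i: "i \<in> {..<d}"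
          have "real (k i) * L i * (\<Prod>i<d. \<rho> i) \<le> real (k i) * L i * \<rho> i"
            using i \<rho> kL0 by (intro mult_left_mono prod_le_factor) auto
          then show "real (k i) * L i * (\<Prod>i<d. \<rho> i) \<le> L i * real (h i)"
            using i h\<rho>[of i] by (simp add: mult_ac)
        qed
        finally have t1: "lam\<^sup>2 * (\<Prod>i<d. real (h i)) / 2 \<le> c * (\<Sum>i<d. L i * real (h i))"
          using c by simp
        \<comment> \<open>So \<open>E \<le> \<kappa>\<^sup>2 * A / 4\<close>, and the square root
          term is at most \<open>\<kappa> * A\<close>. The factor \<open>\<eta>\<close> in
          \<open>\<kappa>\<close> then turns this into \<open>(1 - c) / 2\<close> times the sum of
          \<open>L i * h i\<close>, which raises the coefficient from \<open>c\<close> to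
          \<open>\<gamma>\<close>.\<close>
        have "8 * real (\<Sum>i<d. k i) \<le> \<kappa>\<^sup>2 * A"
          unfolding A_def of_nat_sum sum_distrib_left
        proof (rule sum_mono)
          fix i assume i: "i \<in> {..<d}"
          then have "8 \<le> \<kappa>\<^sup>2 * L i" using L\<kappa>[of i] \<kappa> unfolding \<kappa>_def[symmetric] by (simp add: field_simps)
          then have "8 * real (k i) \<le> \<kappa>\<^sup>2 * L i * real (k i)" by (rule mult_right_mono) simp
          then show "8 * real (k i) \<le> \<kappa>\<^sup>2 * (real (k i) * L i)" by (simp add: mult_ac)
        qed
        then have E4: "4 * E \<le> \<kappa>\<^sup>2 * A" by (simp add: E_def)
        have "(\<Prod>i<d. real (h i)) \<le> (\<Prod>i<d. real (k i))" using h by (intro prod_mono) auto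
        then have "lam\<^sup>2 * (\<Prod>i<d. real (h i)) \<le> lam\<^sup>2 * (\<Prod>i<d. real (k i))"
          by (intro mult_left_mono) auto
        also have "\<dots> \<le> 2 * c * A" by (rule lamA)
        also have "\<dots> \<le> 2 * A" using c A0 by (simp add: mult_left_le_one_le)
        finally have "lam\<^sup>2 * (\<Prod>i<d. real (h i)) * (2 * E) \<le> 2 * A * (2 * E)"
          using E_nonneg by (intro mult_right_mono) auto
        also have "\<dots> = A * (4 * E)" by simp
        also have "\<dots> \<le> A * (\<kappa>\<^sup>2 * A)" using E4 A0 by (intro mult_left_mono)
        also have "\<dots> = (\<kappa> * A)\<^sup>2" by (simp add: power2_eq_square)
        finally have sq: "lam\<^sup>2 * (\<Prod>i<d. real (h i)) * (2 * E) \<le> (\<kappa> * A)\<^sup>2" .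
        have "lam * sqrt (2 * (\<Prod>i<d. real (h i)) * E) = sqrt (lam\<^sup>2 * (\<Prod>i<d. real (h i)) * (2 * E))"
          using lam by (simp add: real_sqrt_mult mult_ac)
        also have "\<dots> \<le> \<kappa> * A"
          using sq \<kappa> A0 by (intro real_le_lsqrt) auto
        also have "\<kappa> * A \<le> (1 - c) / 2 * (\<Sum>i<d. L i * real (h i))"
          unfolding A_def sum_distrib_left
        proof (rule sum_mono)
          fix i assume i: "i \<in> {..<d}"
          have "\<kappa> * (real (k i) * L i) = (1 - c) / 2 * (real (k i) * L i * \<eta>)" by (simp add: \<kappa>_def)
          also have "\<dots> \<le> (1 - c) / 2 * (real (k i) * L i * \<rho> i)"
            using i True kL0 c by (intro mult_left_mono) auto
          finally show "\<kappa> * (real (k i) * L i) \<le> (1 - c) / 2 * (L i * real (h i))"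
            using i h\<rho>[of i] by (simp add: mult_ac)
        qed
        finally have "lam\<^sup>2 * (\<Prod>i<d. real (h i)) / 2 + lam * sqrt (2 * (\<Prod>i<d. real (h i)) * E)
          \<le> c * (\<Sum>i<d. L i * real (h i)) + (1 - c) / 2 * (\<Sum>i<d. L i * real (h i))"
          using t1 by linarith
        also have "\<dots> = (\<Sum>i<d. \<gamma> * L i * real (h i))"
          unfolding mult.assoc sum_distrib_left[symmetric] distrib_right[symmetric]
          by (simp add: \<gamma>_def field_simps)
        finally have "overlap_bound (\<Prod>i<d. real (h i)) \<le> exp (\<Sum>i<d. \<gamma> * L i * real (h i))"
          by (intro order.trans[OF le2]) simp
        also have "\<dots> = (\<Prod>i<d. q i (h i))"
          unfolding exp_sum[OF finite_lessThan]
        proof (rule prod.cong[OF refl])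
          fix i assume i: "i \<in> {..<d}"
          then have "\<eta> * real (k i) \<le> real (h i)" using True kpos[of i] by (simp add: \<rho>_def le_divide_eq)
          then show "exp (\<gamma> * L i * real (h i)) = q i (h i)" by (simp add: q_def)
        qed
        finally show ?thesis using g0 exp_ge_zero[of \<delta>] by linarith
      next
        case sm: False
        then obtain i0 where i0: "i0 < d" "\<rho> i0 < \<eta>" by (auto simp: not_le)
        have "\<exists>j<d. M j < real (h j) \<and>
          lam\<^sup>2 * (\<Prod>i<d. real (h i)) \<le> real (h j) * (2 * C * L j * min \<eta> (\<rho> j) + 1)"
        proof -
          have "\<exists>j\<in>{..<d}. \<forall>i\<in>{..<d}. \<rho> i \<le> \<rho> j"
          proof -
            have "Max (\<rho> ` {..<d}) \<in> \<rho> ` {..<d}" using i0 by (intro Max_in) auto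
            then obtain j where "j < d" "Max (\<rho> ` {..<d}) = \<rho> j" by auto
            then show ?thesis using Max_ge[of "\<rho> ` {..<d}"] by (metis finite_imageI finite_lessThan imageI lessThan_iff)
          qed
          \<comment> \<open>The coordinate \<open>m\<close> of largest overlap ratio serves as \<open>j\<close> if it exceeds its cutoff; if not, all
            ratios are tiny and any coordinate above its cutoff will do.\<close>
          then obtain m where m: "m < d" "\<And>i. i < d \<Longrightarrow> \<rho> i \<le> \<rho> m" by auto
          show ?thesis
          proof (cases "M m < real (h m)")
            case True
            \<comment> \<open>The witness is \<open>i0\<close>, unless \<open>i0\<close> is
              \<open>m\<close> itself. In that case the largest ratio is below \<open>\<eta>\<close>
              and any other coordinate works.\<close>
            have "\<exists>i<d. i \<noteq> m \<and> \<rho> i \<le> min \<eta> (\<rho> m)"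
            proof (cases "i0 = m")
              case True
              obtain i where i: "i < d" "i \<noteq> m"
                using d by (metis One_nat_def Suc_1 Suc_le_lessD less_2_cases_iff less_le_trans not_less_eq zero_neq_one)
              then show ?thesis using m i0 True by (intro exI[of _ i]) fastforce
            next
              case False
              then show ?thesis using m i0 by (intro exI[of _ i0]) auto
            qed
            then obtain i where i: "i < d" "i \<noteq> m" "\<rho> i \<le> min \<eta> (\<rho> m)" by blast
            have "lam\<^sup>2 * (\<Prod>i<d. real (h i)) \<le> real (h m) * (2 * C * L m * \<rho> i)"
              using i m by (intro two) auto
            also have "\<dots> \<le> real (h m) * (2 * C * L m * min \<eta> (\<rho> m))"
              using i C L0[OF m(1)] by (intro mult_left_mono) auto
            also have "\<dots> \<le> real (h m) * (2 * C * L m * min \<eta> (\<rho> m) + 1)"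
              by (intro mult_left_mono) auto
            finally show ?thesis using True m by blast
          next
            case hm: False
            obtain j where j: "j < d" "M j < real (h j)" using False by (auto simp: not_le)
            have jm: "m \<noteq> j" using hm j by auto
            have "lam\<^sup>2 * (\<Prod>i<d. real (h i)) \<le> real (h j) * (2 * C * L j * \<rho> m)"
              using m j jm by (intro two) auto
            also have "\<dots> \<le> real (h j) * (0 + 1)"
            proof (intro mult_left_mono)
              \<comment> \<open>\<open>\<rho> m\<close> is below its cutoff, so \<open>cut\<close>
                with \<open>\<omega> \<ge> 1\<close> bounds the exponent per unit of
                \<open>h j\<close> by \<open>\<delta> \<le> 1\<close>.\<close>
              let ?X = "2 * C * L j * (M m / real (k m))"
              have X0: "0 \<le> ?X" using C L0[OF j(1)] \<omega> \<omega>M[of m] by (intro mult_nonneg_nonneg divide_nonneg_nonneg) auto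
              have "2 * C * L j * \<rho> m \<le> ?X"
                using \<rho>M[of m] m hm C L0[OF j(1)] by (intro mult_left_mono) auto
              also have "?X \<le> \<omega> * ?X" using X0 \<omega> by (metis mult_right_mono mult_1)
              also have "\<dots> \<le> \<delta>" unfolding M_def using m j jm by (intro cut) auto
              finally show "2 * C * L j * \<rho> m \<le> 0 + 1" using \<delta> by linarith
            qed simp
            also have "\<dots> \<le> real (h j) * (2 * C * L j * min \<eta> (\<rho> j) + 1)"
              using \<rho>[OF j(1)] C L0[OF j(1)] \<eta> by (intro mult_left_mono add_right_mono mult_nonneg_nonneg) auto
            finally show ?thesis using j by blast
          qed
        qed
        then obtain j where j: "j < d" "M j < real (h j)"
          "lam\<^sup>2 * (\<Prod>i<d. real (h i)) \<le> real (h j) * (2 * C * L j * min \<eta> (\<rho> j) + 1)" by blast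
        have "overlap_bound (\<Prod>i<d. real (h i)) \<le> exp (real (h j) * (2 * C * L j * min \<eta> (\<rho> j) + 1))"
          using j(3) by (intro order.trans[OF le1]) simp
        also have "\<dots> = g j (h j)" using j by (simp add: g_def \<rho>_def)
        also have "\<dots> \<le> (\<Sum>j<d. g j (h j))"
          using j by (intro member_le_sum) (auto simp: g_def)
        finally show ?thesis using q0 exp_ge_zero[of \<delta>] by linarith
      qed
    qed
  qed
  have ov: "overlap_sum (n j) (k j) (g j) \<le> 2 * exp (- \<omega>)" if j: "j < d" for j
  proof -
    have "overlap_sum (n j) (k j) (g j) \<le> 2 * exp (- M j)"
      unfolding g_def
    proof (rule overlap_sum_tail)
      show "1 \<le> n j" using k[OF j] by linarith
      show "0 \<le> M j" using \<omega>M[of j] \<omega> by linarith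
      fix h assume "h \<le> k j" "M j < real h"
      then show "real h * (2 * C * L j * min \<eta> (real h / real (k j)) + 1)
          + real h * (1 + ln ((real (k j))\<^sup>2 / (real h * real (n j)))) \<le> - (2 * real h)"
        using k[OF j] \<omega> C \<eta> Lexp[OF j] L16[OF j] unfolding M_def
        by (intro planted_exponent_le[where \<omega> = \<omega>]) (auto simp: L_def)
    qed
    also have "\<dots> \<le> 2 * exp (- \<omega>)" using \<omega>M by simp
    finally show ?thesis .
  qed
  have "(\<Sum>j<d. overlap_sum (n j) (k j) (g j)) \<le> (\<Sum>j<d. 2 * exp (- \<omega>))"
    using ov by (intro sum_mono) auto
  moreover have "(\<Prod>i<d. overlap_sum (n i) (k i) (q i)) \<le> (\<Prod>i<d. exp (- real (k i)))"
  proof (intro prod_mono conjI)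
    fix i assume "i \<in> {..<d}"
    then have i: "i < d" by simp
    show "0 \<le> overlap_sum (n i) (k i) (q i)"
      unfolding overlap_sum_def by (intro sum_nonneg) (auto simp: q_def)
    show "overlap_sum (n i) (k i) (q i) \<le> exp (- real (k i))"
      unfolding q_def L_def using k[OF i] c \<eta> L\<eta>[OF i]
      by (intro overlap_sum_large) (auto simp: L_def \<gamma>_def)
  qed
  moreover have "(\<Prod>i<d. exp (- real (k i))) = exp (- real (\<Sum>i<d. k i))"
    by (simp add: exp_sum[symmetric] sum_negf)
  ultimately have Q: "exp \<delta> + (\<Sum>j<d. overlap_sum (n j) (k j) (g j)) + (\<Prod>i<d. overlap_sum (n i) (k i) (q i))
    \<le> exp \<delta> + 2 * real d * exp (- \<omega>) + exp (- real (\<Sum>i<d. k i))"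
    by (simp only: sum_constant card_lessThan)
  have main: "1 - sqrt (exp \<delta> + 2 * real d * exp (- \<omega>) + exp (- real (\<Sum>i<d. k i)) - 1
      + 2 * (2 ^ (\<Sum>i<d. k i) * exp (- E))) \<le> minimax_risk d n k lam"
    by (rule minimax_risk_ge[OF dom _ _ Q]) (auto simp: g_def q_def)
  have "2 ^ (\<Sum>i<d. k i) * exp (- E) \<le> exp (real (\<Sum>i<d. k i)) * exp (- E)"
    by (intro mult_right_mono two_power_le_exp) auto
  also have "\<dots> = exp (- real (\<Sum>i<d. k i))" by (simp add: E_def exp_add[symmetric])
  finally have "sqrt (exp \<delta> + 2 * real d * exp (- \<omega>) + exp (- real (\<Sum>i<d. k i)) - 1
      + 2 * (2 ^ (\<Sum>i<d. k i) * exp (- E)))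
    \<le> sqrt (exp \<delta> - 1 + 2 * real d * exp (- \<omega>) + 3 * exp (- real (\<Sum>i<d. k i)))"
    by (intro real_sqrt_le_mono) simp
  then show ?thesis using main by linarith
qed

section \<open>Asymptotic regimes\<close>

text \<open>\<open>\<delta>\<close> and \<open>\<omega>\<close> are fixed before the limit, chosen
  so that each of the three terms under the root is at most
  \<open>\<epsilon>\<^sup>2 / 4\<close>.\<close>

lemma tendsto_1_of_sqrt_bounds:
  fixes r :: "nat \<Rightarrow> real" and b :: real
  assumes le: "eventually (\<lambda>t. r t \<le> 1) sequentially" and b: "0 < b"
    and ge: "\<And>\<delta> \<omega>. 0 < \<delta> \<Longrightarrow> \<delta> \<le> 1 \<Longrightarrow> 1 \<le> \<omega> \<Longrightarrow>
      eventually (\<lambda>t. 1 - sqrt (exp \<delta> - 1 + b * exp (- \<omega>) + \<delta>) \<le> r t) sequentially"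
  shows "r \<longlonglongrightarrow> 1"
proof (rule tendstoI)
  fix \<epsilon> :: real assume \<epsilon>: "0 < \<epsilon>"
  define \<delta> where "\<delta> = min 1 (min (ln (1 + \<epsilon>\<^sup>2 / 4)) (\<epsilon>\<^sup>2 / 4))"
  define \<omega> where "\<omega> = max 1 (ln (b * 4 / \<epsilon>\<^sup>2))"
  have e2: "0 < \<epsilon>\<^sup>2 / 4" using \<epsilon> by simp
  have \<delta>: "0 < \<delta>" "\<delta> \<le> 1" using e2 by (auto simp: \<delta>_def ln_gt_zero)
  have "exp \<delta> \<le> exp (ln (1 + \<epsilon>\<^sup>2 / 4))" by (simp add: \<delta>_def)
  then have 1: "exp \<delta> - 1 \<le> \<epsilon>\<^sup>2 / 4" using e2 by simp
  have "exp (- \<omega>) \<le> exp (- ln (b * 4 / \<epsilon>\<^sup>2))" by (simp add: \<omega>_def)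
  then have "b * exp (- \<omega>) \<le> b * (\<epsilon>\<^sup>2 / (4 * b))"
    using b \<epsilon> by (intro mult_left_mono) (auto simp: exp_minus field_simps)
  then have 2: "b * exp (- \<omega>) \<le> \<epsilon>\<^sup>2 / 4" using b by (simp add: field_simps)
  have 3: "\<delta> \<le> \<epsilon>\<^sup>2 / 4" by (simp add: \<delta>_def)
  have "exp \<delta> - 1 + b * exp (- \<omega>) + \<delta> < \<epsilon>\<^sup>2" using 1 2 3 e2 by linarith
  then have "sqrt (exp \<delta> - 1 + b * exp (- \<omega>) + \<delta>) < sqrt (\<epsilon>\<^sup>2)" by (rule real_sqrt_less_mono)
  then have s: "sqrt (exp \<delta> - 1 + b * exp (- \<omega>) + \<delta>) < \<epsilon>" using \<epsilon> by simp
  have "eventually (\<lambda>t. 1 - sqrt (exp \<delta> - 1 + b * exp (- \<omega>) + \<delta>) \<le> r t) sequentially"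
    by (rule ge) (use \<delta> in \<open>auto simp: \<omega>_def\<close>)
  with le show "eventually (\<lambda>t. dist (r t) 1 < \<epsilon>) sequentially"
    by eventually_elim (use s in \<open>auto simp: dist_real_def\<close>)
qed

section \<open>Polynomial scaling, regime (A2)\<close>

lemma tendsto_0_of_log_ratio:
  fixes f :: "nat \<Rightarrow> real"
  assumes "\<And>t. 0 < f t" "(\<lambda>t. ln (f t) / ln (real t)) \<longlonglongrightarrow> c" "c < 0"
  shows "f \<longlonglongrightarrow> 0"
proof -
  have "filterlim (\<lambda>t. ln (real t)) at_top sequentially"
    by (rule filterlim_compose[OF ln_at_top filterlim_real_sequentially])
  then have "filterlim (\<lambda>t. ln (f t) / ln (real t) * ln (real t)) at_bot sequentially"
    by (rule filterlim_tendsto_neg_mult_at_bot[OF assms(2,3)])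
  then have lim: "(\<lambda>t. exp (ln (f t) / ln (real t) * ln (real t))) \<longlonglongrightarrow> 0"
    by (rule filterlim_compose[OF exp_at_bot])
  \<comment> \<open>Cancelling \<open>ln t\<close> requires \<open>t > 1\<close>.\<close>
  have "eventually (\<lambda>t. exp (ln (f t) / ln (real t) * ln (real t)) = f t) sequentially"
    using eventually_gt_at_top[of 1]
  proof eventually_elim
    case (elim t)
    then have "ln (real t) \<noteq> 0" by simp
    then show ?case using assms(1)[of t] by simp
  qed
  then show ?thesis by (rule Lim_transform_eventually[OF lim])
qed

lemma minimax_risk_le_1:
  assumes "\<And>i. i < d \<Longrightarrow> k i \<le> n i" "0 \<le> lam"
  shows "minimax_risk d n k lam \<le> 1"
proof -
  interpret planted d n lam k 0 by unfold_locales (use assms in auto)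
  show ?thesis by (rule minimax_risk_le_1)
qed

text \<open>\<open>balanced_risk_bound\<close> needs
  \<open>X = \<lambda>\<^sup>2 K\<^sup>d\<^sup>-\<^sup>1\<close> and
  \<open>Y = \<lambda>\<^sup>2 (K\<^sup>2 / N)\<^sup>d\<close> to vanish. On the logarithmic scale
  they have exponents \<open>- 2 * \<beta> + (d - 1) * \<alpha>\<close> and
  \<open>- 2 * \<beta> + d * (2 * \<alpha> - 1)\<close>, both negative exactly when
  \<open>\<beta>\<close> exceeds the stated maximum.\<close>

theorem chc_detection_lower_bound_A2:
  fixes lam :: "nat \<Rightarrow> real"
  assumes d: "2 \<le> d" and A2: "regime_A2 d n k lam \<alpha> \<beta>" and lam: "\<And>t. 0 < lam t"
    and kn: "\<And>t i. i < d \<Longrightarrow> 1 \<le> k t i \<and> k t i \<le> n t i"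
    and \<beta>: "max (real d * \<alpha> - real d / 2) ((real d - 1) * \<alpha> / 2) < \<beta>"
  shows "(\<lambda>t. minimax_risk d (n t) (k t) (lam t)) \<longlonglongrightarrow> 1"
proof -
  obtain N K where NK: "\<And>t i. i < d \<Longrightarrow> n t i = N t \<and> k t i = K t"
    and limN: "(\<lambda>t. ln (real (N t)) / ln (real t)) \<longlonglongrightarrow> 1"
    and limK: "(\<lambda>t. ln (real (K t)) / ln (real t)) \<longlonglongrightarrow> \<alpha>"
    and liml: "(\<lambda>t. ln (1 / lam t) / ln (real t)) \<longlonglongrightarrow> \<beta>"
    using A2 unfolding regime_A2_def by blast
  have K: "1 \<le> K t" "K t \<le> N t" for t
    using kn[of 0 t] NK[of 0 t] d by auto
  have Kpos: "0 < real (K t)" "0 < real (N t)" for t using K[of t] by auto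
  define X where "X = (\<lambda>t. (lam t)\<^sup>2 * real (K t) ^ (d - 1))"
  define Y where "Y = (\<lambda>t. (lam t)\<^sup>2 * ((real (K t))\<^sup>2 / real (N t)) ^ d)"
  have "(\<lambda>t. - 2 * (ln (1 / lam t) / ln (real t)) + real (d - 1) * (ln (real (K t)) / ln (real t)))
      \<longlonglongrightarrow> - 2 * \<beta> + real (d - 1) * \<alpha>"
    by (intro tendsto_intros limK liml)
  moreover have "ln (X t) / ln (real t)
      = - 2 * (ln (1 / lam t) / ln (real t)) + real (d - 1) * (ln (real (K t)) / ln (real t))" for t
  proof -
    have "ln (X t) = 2 * ln (lam t) + real (d - 1) * ln (real (K t))"
      using lam[of t] Kpos[of t] by (simp add: X_def ln_mult ln_realpow)
    then show ?thesis using lam[of t] by (simp add: ln_div add_divide_distrib)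
  qed
  moreover have "0 < X t" for t
    unfolding X_def using lam Kpos by (intro mult_pos_pos zero_less_power)
  ultimately have limX: "X \<longlonglongrightarrow> 0"
    using \<beta> d by (intro tendsto_0_of_log_ratio[where c = "- 2 * \<beta> + real (d - 1) * \<alpha>"])
      (auto simp: of_nat_diff)
  have "(\<lambda>t. - 2 * (ln (1 / lam t) / ln (real t))
      + real d * (2 * (ln (real (K t)) / ln (real t)) - ln (real (N t)) / ln (real t)))
      \<longlonglongrightarrow> - 2 * \<beta> + real d * (2 * \<alpha> - 1)"
    by (intro tendsto_intros limK liml limN)
  moreover have "ln (Y t) / ln (real t) = - 2 * (ln (1 / lam t) / ln (real t))
      + real d * (2 * (ln (real (K t)) / ln (real t)) - ln (real (N t)) / ln (real t))" for t
  proof -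
    have "ln (Y t) = 2 * ln (lam t) + real d * (2 * ln (real (K t)) - ln (real (N t)))"
      using lam[of t] Kpos[of t] by (simp add: Y_def ln_mult ln_div ln_realpow)
    then show ?thesis using lam[of t] by (simp add: ln_div add_divide_distrib diff_divide_distrib right_diff_distrib)
  qed
  moreover have "0 < Y t" for t
    unfolding Y_def using lam Kpos by (intro mult_pos_pos zero_less_power divide_pos_pos)
  moreover have "- 2 * \<beta> + real d * (2 * \<alpha> - 1) < 0"
    using \<beta> by (simp add: algebra_simps)
  ultimately have limY: "Y \<longlonglongrightarrow> 0"
    by (intro tendsto_0_of_log_ratio[where c = "- 2 * \<beta> + real d * (2 * \<alpha> - 1)"]) simp_all
  show ?thesis
  proof (rule tendsto_1_of_sqrt_bounds[where b = "2 * real d + 2"])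
    show "eventually (\<lambda>t. minimax_risk d (n t) (k t) (lam t) \<le> 1) sequentially"
      using kn lam by (intro always_eventually allI minimax_risk_le_1) (auto intro: less_imp_le)
    fix \<delta> \<omega> :: real assume \<delta>: "0 < \<delta>" "\<delta> \<le> 1" and \<omega>: "1 \<le> \<omega>"
    have "(\<lambda>t. X t * \<omega> ^ d + exp 5 ^ d * Y t) \<longlonglongrightarrow> 0 * \<omega> ^ d + exp 5 ^ d * 0"
      by (intro tendsto_intros limX limY)
    then have "eventually (\<lambda>t. X t * \<omega> ^ d + exp 5 ^ d * Y t < \<delta>) sequentially"
      using \<delta> by (intro order_tendstoD) auto
    moreover have "eventually (\<lambda>t. X t < 1) sequentially"
      using limX by (intro order_tendstoD) auto
    ultimately show "eventually (\<lambda>t. 1 - sqrt (exp \<delta> - 1 + (2 * real d + 2) * exp (- \<omega>) + \<delta>)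
        \<le> minimax_risk d (n t) (k t) (lam t)) sequentially"
    proof eventually_elim
      case (elim t)
      let ?c = "exp 5 * (real (K t))\<^sup>2 / real (N t)"
      \<comment> \<open>The maximum is replaced by a sum: the floor \<open>\<omega>\<close> is
        handled by \<open>X\<close>, because \<open>lam\<^sup>2 \<le> X\<close>, and the mean
        overlap by \<open>Y\<close>.\<close>
      have "overlap_cutoff \<omega> (N t) (K t) ^ d \<le> \<omega> ^ d + ?c ^ d"
        using \<omega> by (auto simp: overlap_cutoff_def max_def)
      then have "(lam t)\<^sup>2 * overlap_cutoff \<omega> (N t) (K t) ^ d \<le> (lam t)\<^sup>2 * (\<omega> ^ d + ?c ^ d)"
        by (intro mult_left_mono) auto
      also have "\<dots> = (lam t)\<^sup>2 * \<omega> ^ d + exp 5 ^ d * Y t"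
        by (simp add: Y_def power_mult_distrib power_divide algebra_simps)
      also have "\<dots> \<le> X t * \<omega> ^ d + exp 5 ^ d * Y t"
      proof -
        have "(lam t)\<^sup>2 * 1 \<le> X t"
          unfolding X_def using K[of t] by (intro mult_left_mono one_le_power) auto
        then show ?thesis using \<omega> by (intro add_right_mono mult_right_mono) auto
      qed
      also have "\<dots> \<le> \<delta>" using elim by simp
      finally have "1 - sqrt (exp \<delta> - 1 + (2 * real d + 2) * exp (- \<omega>)) \<le> minimax_risk d (n t) (k t) (lam t)"
        using d NK K lam[of t] \<omega> elim by (intro balanced_risk_bound[where N = "N t" and K = "K t"]) (auto simp: X_def)
      moreover have "sqrt (exp \<delta> - 1 + (2 * real d + 2) * exp (- \<omega>)) \<le> sqrt (exp \<delta> - 1 + (2 * real d + 2) * exp (- \<omega>) + \<delta>)"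
        using \<delta> by simp
      ultimately show ?case by linarith
    qed
  qed simp
qed

section \<open>Comparable dimensions, regime (A1)\<close>

lemma linear_exp_half_le_1:
  fixes C L :: real
  assumes "0 \<le> C" "1 \<le> L" "32 * C \<le> L"
  shows "2 * C * L * exp (- (L / 2)) \<le> 1"
proof -
  \<comment> \<open>Squaring gives the quadratic bound
    \<open>exp (L / 2) \<ge> L\<^sup>2 / 16\<close>, and \<open>L \<ge> 32 * C\<close> turns it into
    \<open>2 * C * L\<close>.\<close>
  have "L / 4 \<le> exp (L / 4)" using exp_ge_add_one_self[of "L / 4"] by linarith
  then have "(L / 4)\<^sup>2 \<le> (exp (L / 4))\<^sup>2" using assms by (intro power_mono) auto
  also have "\<dots> = exp (L / 2)" by (simp add: power2_eq_square exp_add[symmetric])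
  finally have 1: "L * L \<le> 16 * exp (L / 2)" by (simp add: power2_eq_square)
  have "32 * C * L \<le> L * L" using assms by (intro mult_right_mono) auto
  then have "2 * C * L \<le> exp (L / 2)" using 1 by linarith
  then show ?thesis by (simp add: exp_minus field_simps)
qed

text \<open>One plus the sum of all pairwise constants serves every \<open>j\<close> at
  once.\<close>

lemma asymp_same_order_sum_bound:
  fixes a :: "nat \<Rightarrow> nat \<Rightarrow> real"
  assumes nonneg: "\<And>i. i < d \<Longrightarrow> eventually (\<lambda>t. 0 \<le> a t i) sequentially"
    and same: "\<And>i j. i < d \<Longrightarrow> j < d \<Longrightarrow> i \<noteq> j \<Longrightarrow> asymp_same_order (\<lambda>t. a t i) (\<lambda>t. a t j)"
  obtains C where "1 \<le> C" "eventually (\<lambda>t. \<forall>j<d. (\<Sum>i<d. a t i) \<le> C * a t j) sequentially"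
proof -
  have "\<exists>C>0. eventually (\<lambda>t. a t i \<le> C * a t j) sequentially" if "i < d" "j < d" for i j
  proof (cases "i = j")
    case True
    then show ?thesis by (intro exI[of _ 1]) auto
  next
    case False
    then show ?thesis using same[of j i] that unfolding asymp_same_order_def
      by (auto elim!: eventually_mono)
  qed
  then obtain c where c: "\<And>i j. i < d \<Longrightarrow> j < d \<Longrightarrow> 0 < c i j \<and> eventually (\<lambda>t. a t i \<le> c i j * a t j) sequentially"
    by metis
  define C where "C = 1 + (\<Sum>i<d. \<Sum>j<d. c i j)"
  have c0: "0 \<le> c i j" if "i < d" "j < d" for i j using c[OF that] by simp
  have "eventually (\<lambda>t. (\<Sum>i<d. a t i) \<le> C * a t j) sequentially" if j: "j < d" for j
  proof -
    have "eventually (\<lambda>t. \<forall>i\<in>{..<d}. a t i \<le> c i j * a t j) sequentially"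
      using c j by (intro eventually_ball_finite) auto
    then show ?thesis using nonneg[OF j]
    proof eventually_elim
      case (elim t)
      have "(\<Sum>i<d. a t i) \<le> (\<Sum>i<d. c i j * a t j)" using elim by (intro sum_mono) auto
      also have "\<dots> = (\<Sum>i<d. c i j) * a t j" by (simp add: sum_distrib_right)
      also have "\<dots> \<le> C * a t j"
      proof (rule mult_right_mono)
        have "(\<Sum>i<d. c i j) \<le> (\<Sum>i<d. \<Sum>j<d. c i j)"
          using j c0 by (intro sum_mono member_le_sum) auto
        then show "(\<Sum>i<d. c i j) \<le> C" by (simp add: C_def)
      qed (use elim in simp)
      finally show ?case .
    qed
  qed
  then have "eventually (\<lambda>t. \<forall>j\<in>{..<d}. (\<Sum>i<d. a t i) \<le> C * a t j) sequentially"
    by (intro eventually_ball_finite) auto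
  then have "eventually (\<lambda>t. \<forall>j<d. (\<Sum>i<d. a t i) \<le> C * a t j) sequentially"
    by (auto elim!: eventually_mono)
  moreover have "1 \<le> C" using c0 by (auto simp: C_def intro!: sum_nonneg)
  ultimately show thesis using that by blast
qed

text \<open>The hypotheses of \<open>planted_risk_bound\<close> hold eventually: \<open>same\<close>
  supplies \<open>C\<close>, the limsup condition supplies \<open>c\<close>, \<open>Lk\<close> and
  \<open>lnL\<close> give the cutoff condition and \<open>lim0\<close> the mean condition. The lower
  bounds on \<open>L\<close> hold because every \<open>L t i\<close> tends to infinity.\<close>

theorem chc_detection_lower_bound_A1:
  fixes n k :: "nat \<Rightarrow> nat \<Rightarrow> nat" and lam :: "nat \<Rightarrow> real"
  defines "L \<equiv> \<lambda>t i. ln (real (n t i) / real (k t i))"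
  assumes d: "2 \<le> d" and A1: "regime_A1 d n k" and lam: "\<And>t. 0 < lam t"
    and Lk: "\<And>i j. i < d \<Longrightarrow> j < d \<Longrightarrow> i \<noteq> j \<Longrightarrow> (\<lambda>t. L t j / real (k t i)) \<longlonglongrightarrow> 0"
    and lnL: "\<And>i j. i < d \<Longrightarrow> j < d \<Longrightarrow> i \<noteq> j \<Longrightarrow> (\<lambda>t. ln (L t i) / L t j) \<longlonglongrightarrow> 0"
    and same: "\<And>i j. i < d \<Longrightarrow> j < d \<Longrightarrow> i \<noteq> j \<Longrightarrow>
      asymp_same_order (\<lambda>t. real (k t i) * L t i) (\<lambda>t. real (k t j) * L t j)"
    and lim0: "(\<lambda>t. lam t * (\<Prod>i<d. real (k t i)) / sqrt (\<Prod>i<d. real (n t i))) \<longlonglongrightarrow> 0"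
    and sup: "limsup (\<lambda>t. ereal (lam t * sqrt (\<Prod>i<d. real (k t i)) /
      sqrt (2 * (\<Sum>i<d. real (k t i) * L t i)))) < 1"
  shows "(\<lambda>t. minimax_risk d (n t) (k t) (lam t)) \<longlonglongrightarrow> 1"
proof -
  have L_eq: "ln (real (n t i) / real (k t i)) = L t i" for t i
    by (simp add: L_def)
  define A where "A = (\<lambda>t. \<Sum>i<d. real (k t i) * L t i)"
  have all: "eventually (\<lambda>t. \<forall>i<d. R t i) sequentially"
    if "\<And>i. i < d \<Longrightarrow> eventually (\<lambda>t. R t i) sequentially" for R :: "nat \<Rightarrow> nat \<Rightarrow> bool"
  proof -
    have "eventually (\<lambda>t. \<forall>i\<in>{..<d}. R t i) sequentially"
      using that by (intro eventually_ball_finite) auto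
    then show ?thesis by (auto elim!: eventually_mono)
  qed
  have limk: "filterlim (\<lambda>t. real (k t i)) at_top sequentially"
    and limn: "filterlim (\<lambda>t. real (n t i)) at_top sequentially"
    and limkn: "(\<lambda>t. real (k t i) / real (n t i)) \<longlonglongrightarrow> 0" if "i < d" for i
    using A1 that unfolding regime_A1_def by auto
  have ev_kn: "eventually (\<lambda>t. \<forall>i<d. 1 \<le> k t i \<and> k t i \<le> n t i) sequentially"
  proof (rule all)
    fix i assume i: "i < d"
    have "eventually (\<lambda>t. 1 \<le> real (k t i)) sequentially" "eventually (\<lambda>t. 1 \<le> real (n t i)) sequentially"
      using limk[OF i] limn[OF i] unfolding filterlim_at_top by blast+
    moreover have "eventually (\<lambda>t. real (k t i) / real (n t i) < 1) sequentially"
      using limkn[OF i] by (intro order_tendstoD) auto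
    ultimately show "eventually (\<lambda>t. 1 \<le> k t i \<and> k t i \<le> n t i) sequentially"
      by eventually_elim (auto simp: divide_less_eq)
  qed
  have limL: "filterlim (\<lambda>t. L t i) at_top sequentially" if i: "i < d" for i
  proof -
    have "eventually (\<lambda>t. 0 < real (k t i) / real (n t i)) sequentially"
      using ev_kn by eventually_elim (use i in \<open>auto simp: divide_pos_pos\<close>)
    with limkn[OF i] have "filterlim (\<lambda>t. inverse (real (k t i) / real (n t i))) at_top sequentially"
      by (rule filterlim_inverse_at_top)
    then have "filterlim (\<lambda>t. real (n t i) / real (k t i)) at_top sequentially" by simp
    then show ?thesis unfolding L_def by (rule filterlim_compose[OF ln_at_top])
  qed
  have evL: "eventually (\<lambda>t. \<forall>i<d. B \<le> L t i) sequentially" for B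
    using limL by (intro all) (auto simp: filterlim_at_top)
  have "eventually (\<lambda>t. 0 \<le> real (k t i) * L t i) sequentially" if "i < d" for i
    using evL[of 0] by eventually_elim (use that in auto)
  from asymp_same_order_sum_bound[of d "\<lambda>t i. real (k t i) * L t i", OF this same]
  obtain C where C: "1 \<le> C"
    and AC: "eventually (\<lambda>t. \<forall>j<d. A t \<le> C * (real (k t j) * L t j)) sequentially"
    unfolding A_def by blast
  obtain c where c: "0 < c" "c < 1"
    and lamA: "eventually (\<lambda>t. (lam t)\<^sup>2 * (\<Prod>i<d. real (k t i)) \<le> 2 * c * A t) sequentially"
  proof -
    obtain r where r: "limsup (\<lambda>t. ereal (lam t * sqrt (\<Prod>i<d. real (k t i)) / sqrt (2 * A t))) < ereal r" "ereal r < 1"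
      using ereal_dense2[OF sup] unfolding A_def by blast
    have r1: "r < 1" using r(2) by simp
    \<comment> \<open>The maximum with \<open>1 / 2\<close> makes the constant
      \<open>c = r'\<^sup>2\<close> positive.\<close>
    define r' where "r' = max r (1 / 2)"
    have r': "0 < r'" "r' < 1" "r \<le> r'" using r1 by (auto simp: r'_def)
    have "eventually (\<lambda>t. ereal (lam t * sqrt (\<Prod>i<d. real (k t i)) / sqrt (2 * A t)) < ereal r) sequentially"
      by (rule Limsup_lessD[OF r(1)])
    then have "eventually (\<lambda>t. (lam t)\<^sup>2 * (\<Prod>i<d. real (k t i)) \<le> 2 * r'\<^sup>2 * A t) sequentially"
      using evL[of 1] ev_kn
    proof eventually_elim
      case (elim t)
      have "0 < A t"
        unfolding A_def
      proof (rule sum_pos)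
        show "{..<d} \<noteq> {}" using d by (simp add: lessThan_empty_iff)
        fix i assume "i \<in> {..<d}"
        then have "1 \<le> L t i" "1 \<le> k t i" using elim by auto
        then show "0 < real (k t i) * L t i" by (intro mult_pos_pos) auto
      qed simp
      have "lam t * sqrt (\<Prod>i<d. real (k t i)) / sqrt (2 * A t) \<le> r'" using elim(1) r' by simp
      then have "lam t * sqrt (\<Prod>i<d. real (k t i)) \<le> r' * sqrt (2 * A t)"
        using \<open>0 < A t\<close> by (simp add: divide_le_eq)
      then have "(lam t * sqrt (\<Prod>i<d. real (k t i)))\<^sup>2 \<le> (r' * sqrt (2 * A t))\<^sup>2"
        using lam[of t] by (intro power_mono mult_nonneg_nonneg real_sqrt_ge_zero prod_nonneg) auto
      then show ?case using \<open>0 < A t\<close> by (simp add: power_mult_distrib prod_nonneg mult_ac)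
    qed
    moreover have "r'\<^sup>2 < 1" using r' by (simp add: power_less_one_iff)
    ultimately show thesis using r' by (intro that[of "r'\<^sup>2"]) auto
  qed
  define \<eta> where "\<eta> = 1 / (8 * C)"
  show ?thesis
  proof (rule tendsto_1_of_sqrt_bounds[where b = "2 * real d"])
    show "eventually (\<lambda>t. minimax_risk d (n t) (k t) (lam t) \<le> 1) sequentially"
      using ev_kn
    proof eventually_elim
      case (elim t)
      then show ?case using lam[of t] by (intro minimax_risk_le_1) auto
    qed
    show "0 < 2 * real d" using d by simp
    fix \<delta> \<omega> :: real assume \<delta>: "0 < \<delta>" "\<delta> \<le> 1" and \<omega>: "1 \<le> \<omega>"
    \<comment> \<open>The cutoff over \<open>k i\<close> is at most
      \<open>\<omega> / k i + exp 5 * k i / n i\<close>. Times \<open>L j\<close>, the first part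
      vanishes by \<open>Lk\<close>; the second contains \<open>L j * exp (- L i)\<close>, at most
      \<open>exp (- L i / 2)\<close> once \<open>lnL\<close> gives
      \<open>ln (L j) \<le> L i / 2\<close>.\<close>
    have ev_cut: "eventually (\<lambda>t. \<forall>i<d. \<forall>j<d. i \<noteq> j \<longrightarrow>
      \<omega> * (2 * C * L t j * (overlap_cutoff \<omega> (n t i) (k t i) / real (k t i))) \<le> \<delta>) sequentially"
    proof (intro all)
      fix i j assume ij: "i < d" "j < d"
      show "eventually (\<lambda>t. i \<noteq> j \<longrightarrow>
        \<omega> * (2 * C * L t j * (overlap_cutoff \<omega> (n t i) (k t i) / real (k t i))) \<le> \<delta>) sequentially"
      proof (cases "i = j")
        case False
        have "filterlim (\<lambda>t. L t i * (1 / 2)) at_top sequentially"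
          by (rule filterlim_at_top_mult_tendsto_pos[OF tendsto_const _ limL[OF ij(1)]]) simp
        then have "(\<lambda>t. exp (- (L t i * (1 / 2)))) \<longlonglongrightarrow> 0"
          by (intro filterlim_compose[OF exp_at_bot] filterlim_compose[OF filterlim_uminus_at_bot_at_top])
        moreover have "(\<lambda>t. L t j / real (k t i)) \<longlonglongrightarrow> 0" using Lk ij False by blast
        ultimately have "(\<lambda>t. \<omega> * (2 * C * (\<omega> * (L t j / real (k t i)) + exp 5 * exp (- (L t i * (1 / 2))))))
          \<longlonglongrightarrow> \<omega> * (2 * C * (\<omega> * 0 + exp 5 * 0))"
          by (intro tendsto_intros)
        then have "eventually (\<lambda>t. \<omega> * (2 * C * (\<omega> * (L t j / real (k t i)) + exp 5 * exp (- (L t i * (1 / 2))))) < \<delta>) sequentially"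
          using \<delta> by (intro order_tendstoD) auto
        moreover have "eventually (\<lambda>t. ln (L t j) / L t i < 1 / 2) sequentially"
          using lnL[of j i] ij False by (intro order_tendstoD) auto
        ultimately show ?thesis using ev_kn evL[of 1]
        proof eventually_elim
          case (elim t)
          have k0: "0 < real (k t i)" "0 < real (n t i)" using elim(3) ij by force+
          have L1: "1 \<le> L t i" "1 \<le> L t j" using elim(4) ij by auto
          have "ln (L t j) \<le> L t i * (1 / 2)" using elim(2) L1 by (simp add: divide_less_eq)
          then have "exp (ln (L t j)) \<le> exp (L t i * (1 / 2))" by simp
          then have "L t j \<le> exp (L t i * (1 / 2))" using L1 by simp
          moreover have "real (k t i) / real (n t i) = exp (- L t i)"
            using k0 by (simp add: L_def ln_div exp_diff)
          ultimately have "L t j * (real (k t i) / real (n t i)) \<le> exp (L t i * (1 / 2)) * exp (- L t i)"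
            by (simp add: mult_right_mono)
          also have "\<dots> = exp (- (L t i * (1 / 2)))" by (simp add: exp_add[symmetric])
          finally have *: "L t j * (real (k t i) / real (n t i)) \<le> exp (- (L t i * (1 / 2)))" .
          have "overlap_cutoff \<omega> (n t i) (k t i) \<le> \<omega> + exp 5 * (real (k t i))\<^sup>2 / real (n t i)"
            using \<omega> by (auto simp: overlap_cutoff_def max_def)
          then have "overlap_cutoff \<omega> (n t i) (k t i) / real (k t i)
              \<le> (\<omega> + exp 5 * (real (k t i))\<^sup>2 / real (n t i)) / real (k t i)"
            using k0 by (intro divide_right_mono) auto
          also have "\<dots> = \<omega> / real (k t i) + exp 5 * (real (k t i) / real (n t i))"
            using k0 by (simp add: add_divide_distrib power2_eq_square)
          finally have "L t j * (overlap_cutoff \<omega> (n t i) (k t i) / real (k t i))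
              \<le> L t j * (\<omega> / real (k t i) + exp 5 * (real (k t i) / real (n t i)))"
            using L1 by (intro mult_left_mono) auto
          also have "\<dots> = \<omega> * (L t j / real (k t i)) + exp 5 * (L t j * (real (k t i) / real (n t i)))"
            by (simp add: algebra_simps)
          also have "\<dots> \<le> \<omega> * (L t j / real (k t i)) + exp 5 * exp (- (L t i * (1 / 2)))"
            using * by (intro add_left_mono mult_left_mono) auto
          finally have "\<omega> * (2 * C * (L t j * (overlap_cutoff \<omega> (n t i) (k t i) / real (k t i))))
              \<le> \<omega> * (2 * C * (\<omega> * (L t j / real (k t i)) + exp 5 * exp (- (L t i * (1 / 2)))))"
            using C \<omega> by (intro mult_left_mono) auto
          then show ?case using elim(1) by (simp add: mult.assoc)
        qed
      qed simp
    qed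
    \<comment> \<open>The left side is \<open>exp 5 ^ d\<close> times the square of the sequence in
      \<open>lim0\<close>.\<close>
    have ev_mean: "eventually (\<lambda>t. (lam t)\<^sup>2 * (\<Prod>i<d. exp 5 * (real (k t i))\<^sup>2 / real (n t i)) \<le> \<delta>) sequentially"
    proof -
      have "(\<lambda>t. exp 5 ^ d * (lam t * (\<Prod>i<d. real (k t i)) / sqrt (\<Prod>i<d. real (n t i)))\<^sup>2) \<longlonglongrightarrow> exp 5 ^ d * 0\<^sup>2"
        by (intro tendsto_intros lim0)
      then have "eventually (\<lambda>t. exp 5 ^ d * (lam t * (\<Prod>i<d. real (k t i)) / sqrt (\<Prod>i<d. real (n t i)))\<^sup>2 < \<delta>) sequentially"
        using \<delta> by (intro order_tendstoD) auto
      then show ?thesis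
      proof eventually_elim
        case (elim t)
        have "(lam t)\<^sup>2 * (\<Prod>i<d. exp 5 * (real (k t i))\<^sup>2 / real (n t i))
          = exp 5 ^ d * (lam t * (\<Prod>i<d. real (k t i)) / sqrt (\<Prod>i<d. real (n t i)))\<^sup>2"
          by (simp add: prod.distrib prod_dividef power_mult_distrib power_divide prod_power_distrib prod_nonneg)
        then show ?case using elim by linarith
      qed
    qed
    have ev_k: "eventually (\<lambda>t. 3 * exp (- real (\<Sum>i<d. k t i)) \<le> \<delta>) sequentially"
    proof -
      have d0: "0 < d" using d by simp
      have "eventually (\<lambda>t. - ln (\<delta> / 3) \<le> real (k t 0)) sequentially"
        using limk[OF d0] by (auto simp: filterlim_at_top)
      then show ?thesis
      proof eventually_elim
        case (elim t)
        have "k t 0 \<le> (\<Sum>i<d. k t i)" using d0 by (intro member_le_sum) auto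
        then have "- real (\<Sum>i<d. k t i) \<le> ln (\<delta> / 3)" using elim by linarith
        then have "exp (- real (\<Sum>i<d. k t i)) \<le> \<delta> / 3"
          using \<delta> by (metis exp_le_cancel_iff exp_ln divide_pos_pos zero_less_numeral)
        then show ?case by simp
      qed
    qed
    \<comment> \<open>All thresholds on \<open>L\<close> at once; \<open>32 * C\<close> comes from
      \<open>linear_exp_half_le_1\<close>.\<close>
    let ?B = "max (max 16 (32 * C)) (max (2 / ((1 - (1 + c) / 2) * \<eta>)) (8 / ((1 - c) * \<eta> / 2)\<^sup>2))"
    show "eventually (\<lambda>t. 1 - sqrt (exp \<delta> - 1 + 2 * real d * exp (- \<omega>) + \<delta>)
        \<le> minimax_risk d (n t) (k t) (lam t)) sequentially"
      using ev_kn AC lamA ev_cut ev_mean ev_k evL[of ?B]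
    proof eventually_elim
      case (elim t)
      have LB: "?B \<le> L t i" if "i < d" for i using elim(7) that by blast
      have "1 - sqrt (exp \<delta> - 1 + 2 * real d * exp (- \<omega>) + 3 * exp (- real (\<Sum>i<d. k t i)))
          \<le> minimax_risk d (n t) (k t) (lam t)"
      proof (rule planted_risk_bound[where C = C and c = c and n = "n t" and k = "k t", unfolded L_eq, folded \<eta>_def])
        show "2 \<le> d" "0 \<le> lam t" "1 \<le> \<omega>" "\<delta> \<le> 1" "1 \<le> C" "0 < c" "c < 1"
          using d lam[of t] \<omega> \<delta> C c by auto
        show "(lam t)\<^sup>2 * (\<Prod>i<d. real (k t i)) \<le> 2 * c * (\<Sum>i<d. real (k t i) * L t i)"
          using elim(3) by (simp add: A_def)
        show "(lam t)\<^sup>2 * (\<Prod>i<d. exp 5 * (real (k t i))\<^sup>2 / real (n t i)) \<le> \<delta>" by (rule elim(5))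
        fix j assume j: "j < d"
        show "1 \<le> k t j \<and> k t j \<le> n t j" using elim(1) j by blast
        show "(\<Sum>i<d. real (k t i) * L t i) \<le> C * (real (k t j) * L t j)"
          using elim(2) j by (simp add: A_def)
        show "16 \<le> L t j" "2 / ((1 - (1 + c) / 2) * \<eta>) \<le> L t j" "8 / ((1 - c) * \<eta> / 2)\<^sup>2 \<le> L t j"
          using LB[OF j] by simp_all
        show "2 * C * L t j * exp (- (L t j / 2)) \<le> 1"
          using LB[OF j] C by (intro linear_exp_half_le_1) simp_all
        fix i assume "i < d" "i \<noteq> j"
        then show "\<omega> * (2 * C * L t j * (overlap_cutoff \<omega> (n t i) (k t i) / real (k t i))) \<le> \<delta>"
          using elim(4) j by blast
      qed
      moreover have "sqrt (exp \<delta> - 1 + 2 * real d * exp (- \<omega>) + 3 * exp (- real (\<Sum>i<d. k t i)))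
          \<le> sqrt (exp \<delta> - 1 + 2 * real d * exp (- \<omega>) + \<delta>)"
        using elim(6) by (intro real_sqrt_le_mono) simp
      ultimately show ?case by linarith
    qed
  qed
qed

theorem mainTheorem4:
  fixes d :: nat
  assumes "2 \<le> d"
  shows
   "(\<forall>(n :: nat \<Rightarrow> nat \<Rightarrow> nat) (k :: nat \<Rightarrow> nat \<Rightarrow> nat) (lam :: nat \<Rightarrow> real).
      regime_A1 d n k \<and> (\<forall>t. lam t > 0) \<and>
      (\<forall>i<d. \<forall>j<d. i \<noteq> j \<longrightarrow>
         (\<lambda>t. ln (real (n t j) / real (k t j)) / real (k t i)) \<longlonglongrightarrow> 0 \<and>
         (\<lambda>t. ln (ln (real (n t i) / real (k t i))) / ln (real (n t j) / real (k t j))) \<longlonglongrightarrow> 0 \<and>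
         asymp_same_order (\<lambda>t. real (k t i) * ln (real (n t i) / real (k t i)))
                          (\<lambda>t. real (k t j) * ln (real (n t j) / real (k t j)))) \<and>
      (\<lambda>t. lam t * (\<Prod>i<d. real (k t i)) / sqrt (\<Prod>i<d. real (n t i))) \<longlonglongrightarrow> 0 \<and>
      limsup (\<lambda>t. ereal (lam t * sqrt (\<Prod>i<d. real (k t i)) /
               sqrt (2 * (\<Sum>i<d. real (k t i) * ln (real (n t i) / real (k t i)))))) < 1
      \<longrightarrow> (\<lambda>t. minimax_risk d (n t) (k t) (lam t)) \<longlonglongrightarrow> 1)
    \<and>
    (\<forall>(n :: nat \<Rightarrow> nat \<Rightarrow> nat) (k :: nat \<Rightarrow> nat \<Rightarrow> nat) (lam :: nat \<Rightarrow> real) (\<alpha> :: real) (\<beta> :: real).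
      regime_A2 d n k lam \<alpha> \<beta> \<and> (\<forall>t. lam t > 0) \<and>
      (\<forall>t. \<forall>i<d. 1 \<le> k t i \<and> k t i \<le> n t i) \<and>
      \<beta> > max (real d * \<alpha> - real d / 2) ((real d - 1) * \<alpha> / 2)
      \<longrightarrow> (\<lambda>t. minimax_risk d (n t) (k t) (lam t)) \<longlonglongrightarrow> 1)"
  using assms
  by (intro conjI allI impI)
     (rule chc_detection_lower_bound_A1 chc_detection_lower_bound_A2; blast)+

end
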